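(* Let $p$ be a prime, let $G$ be a finite non-abelian $p$-group and let $n\geq 2$. Suppose $Aut_{Z(G)}^{\gamma_{n}(G)}(G) = Autcent(G)$. Then: (1) $\gamma_{n}(G)\leq Z(G)$ and $d(\gamma_n(G)) = d(Z(G))$. (2) If $exp(G/\gamma_2(G))>var(\gamma_{n}(G),Z(G))$, then $\gamma_{n}(G) = Z(G)$. Conversely, if $\gamma_{n}(G)=Z(G)$, then $exp(G/\gamma_2(G))>var(\gamma_{n}(G),Z(G))$ and $Aut_{Z(G)}^{\gamma_{n}(G)}(G) = Autcent(G)$.
   Context: $Z(G)$ is the center of $G$ and $\gamma_n(G)$ is the $n$-th term of the lower central series, with $\gamma_1(G)=G$. $Autcent(G)$ is the group of central automorphisms of $G$, i.e. automorphisms $\alpha$ with $g^{-1}\alpha(g)\in Z(G)$ for all $g \in G$. For normal subgroups $M$ and $N$ of $G$: $Aut^{M}(G)$ denotes the group of all automorphisms of $G$ which fix $M$ setwise and act trivially on $G/M$; $Aut_{N}(G)$ denotes the group of all automorphisms of $G$ which fix $N$ elementwise; and $Aut_{N}^{M}(G) = Aut^{M}(G)\cap Aut_{N}(G)$. $exp(K)$ is the exponent of a group $K$ (the smallest positive integer $e$ with $g^e=1$ for all $g\in K$), and $d(K)$ is the rank of a finite abelian group $K$. Definition of $var$: let $A \leq B$ be finite abelian $p$-groups with $d(A)=d(B)=t$ and cyclic decompositions $A = C_{p^{n_1}}\times \cdots \times C_{p^{n_t}}$, $B = C_{p^{m_1}}\times \cdots \times C_{p^{m_t}}$, where $n_i\geq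 n_{i+1}$ and $m_j\geq m_{j+1}$ are positive integers and $C_{p^i}$ is the cyclic group of order $p^i$. If $A$ is a proper subgroup of $B$, there is a unique integer $r$ such that $n_r<m_r$ and $n_j=m_j$ for all $r+1\leq j\leq t$, and one sets $var(A,B)=p^{n_r}$. If $A=B$, one sets $var(A,B)=1$. (In part (2), $var(\gamma_n(G),Z(G))$ makes sense because of part (1).) *)

theory Defs
  imports "HOL-Algebra.Algebra" "HOL-Computational_Algebra.Primes"
begin

definition center :: "('a, 'b) monoid_scheme \<Rightarrow> 'a set" where
  "center G = {z \<in> carrier G. \<forall>g \<in> carrier G. z \<otimes>\<^bsub>G\<^esub> g = g \<otimes>\<^bsub>G\<^esub> z}"

text \<open>The subgroup generated by the commutators of elements of \<open>H\<close> with elements of \<open>K\<close>; the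
  shape of the commutators agrees with \<^const>\<open>derived\<close>.\<close>

definition commutator_subgroup :: "('a, 'b) monoid_scheme \<Rightarrow> 'a set \<Rightarrow> 'a set \<Rightarrow> 'a set" where
  "commutator_subgroup G H K =
     generate G (\<Union>h \<in> H. \<Union>k \<in> K. {h \<otimes>\<^bsub>G\<^esub> k \<otimes>\<^bsub>G\<^esub> inv\<^bsub>G\<^esub> h \<otimes>\<^bsub>G\<^esub> inv\<^bsub>G\<^esub> k})"

text \<open>The series starts at index 1; the value at 0 is a dummy.\<close>

fun lower_central :: "('a, 'b) monoid_scheme \<Rightarrow> nat \<Rightarrow> 'a set" where
  "lower_central G 0 = carrier G"
| "lower_central G (Suc 0) = carrier G"
| "lower_central G (Suc (Suc n)) = commutator_subgroup G (lower_central G (Suc n)) (carrier G)"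

text \<open>The elements of \<^term>\<open>auto G\<close> are extensional functions, so equality of the following sets
  is equality of subgroups of \<^term>\<open>AutoGroup G\<close>.\<close>

definition central_auts :: "('a, 'b) monoid_scheme \<Rightarrow> ('a \<Rightarrow> 'a) set" where
  "central_auts G = {\<alpha> \<in> auto G. \<forall>g \<in> carrier G. inv\<^bsub>G\<^esub> g \<otimes>\<^bsub>G\<^esub> \<alpha> g \<in> center G}"

text \<open>An automorphism stabilising \<open>M\<close> acts on \<^term>\<open>G Mod M\<close> by taking images of cosets.\<close>

definition auts_trivial_mod :: "('a, 'b) monoid_scheme \<Rightarrow> 'a set \<Rightarrow> ('a \<Rightarrow> 'a) set" where
  "auts_trivial_mod G M = {\<alpha> \<in> auto G. \<alpha> ` M = M \<and> (\<forall>C \<in> carrier (G Mod M). \<alpha> ` C = C)}"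

definition auts_fixing :: "('a, 'b) monoid_scheme \<Rightarrow> 'a set \<Rightarrow> ('a \<Rightarrow> 'a) set" where
  "auts_fixing G N = {\<alpha> \<in> auto G. \<forall>x \<in> N. \<alpha> x = x}"

definition group_exp :: "('a, 'b) monoid_scheme \<Rightarrow> nat" where
  "group_exp G = (LEAST e. 0 < e \<and> (\<forall>g \<in> carrier G. g [^]\<^bsub>G\<^esub> e = \<one>\<^bsub>G\<^esub>))"

text \<open>The rank of a finite group is the least size of a generating set.\<close>

definition group_rank :: "('a, 'b) monoid_scheme \<Rightarrow> nat" where
  "group_rank G = (LEAST d. \<exists>S \<subseteq> carrier G. finite S \<and> card S = d \<and> generate G S = carrier G)"

text \<open>\<open>cyclic_type p A ns\<close>: \<open>A\<close> is the direct product of cyclic groups of orders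
  \<open>p ^ n\<close> for the entries \<open>n\<close> of the nonincreasing list \<open>ns\<close> of positive numbers.\<close>

definition cyclic_type :: "nat \<Rightarrow> ('a, 'b) monoid_scheme \<Rightarrow> nat list \<Rightarrow> bool" where
  "cyclic_type p A ns \<longleftrightarrow>
     sorted_wrt (\<ge>) ns \<and> (\<forall>n \<in> set ns. 0 < n) \<and>
     A \<cong> product_group {..<length ns} (\<lambda>i. integer_mod_group (p ^ (ns ! i)))"

text \<open>Intended for \<open>p\<close>-subgroups \<open>A \<subseteq> B\<close> of \<open>G\<close> that are finite, abelian and of equal
  rank. For \<open>A \<noteq> B\<close> the lists \<open>ns\<close> and \<open>ms\<close> are then determined by \<open>A\<close> and \<open>B\<close>, and \<open>r\<close>
  (counted from 0) is the last position at which they differ, so the description is unique.\<close>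

definition subgroup_var :: "nat \<Rightarrow> ('a, 'b) monoid_scheme \<Rightarrow> 'a set \<Rightarrow> 'a set \<Rightarrow> nat" where
  "subgroup_var p G A B =
     (if A = B then 1
      else THE v. \<exists>ns ms r.
        cyclic_type p (G\<lparr>carrier := A\<rparr>) ns \<and> cyclic_type p (G\<lparr>carrier := B\<rparr>) ms \<and>
        length ns = length ms \<and> r < length ns \<and> ns ! r < ms ! r \<and>
        (\<forall>j. r < j \<and> j < length ns \<longrightarrow> ns ! j = ms ! j) \<and> v = p ^ (ns ! r))"

end

theory Submission
  imports Defs
begin

text \<open>Suppose that the two automorphism groups agree. Conjugation by an element of \<open>\<gamma>\<^sub>n\<^sub>-\<^sub>1(G)\<close> acts
  trivially on \<open>Z(G)\<close> and modulo \<open>\<gamma>\<^sub>n(G)\<close>, so it is central, and this means \<open>\<gamma>\<^sub>n(G) \<le> Z(G)\<close>. For a homomorphism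
  \<open>f : G \<rightarrow> Z(G)\<close>, the map \<open>g \<mapsto> g f(g)\<close> is a central automorphism as soon as it is injective, and then
  \<open>f\<close> takes values in \<open>\<gamma>\<^sub>n(G)\<close>. Homomorphisms that kill \<open>Z(G)\<close> and hit a given central element of order \<open>p\<close>
  show that \<open>Z(G)\<close> and \<open>\<gamma>\<^sub>n(G)\<close> have the same elements of order \<open>p\<close>, hence the same rank. This in turn
  makes \<open>g \<mapsto> g f(g)\<close> injective for every \<open>f\<close>. As \<open>G/\<gamma>\<^sub>2(G)\<close> has a cyclic direct factor of order
  \<open>p\<^sup>e = exp(G/\<gamma>\<^sub>2(G))\<close>, every \<open>z \<in> Z(G)\<close> of order dividing \<open>p\<^sup>e\<close> is a value of some \<open>f\<close> and lies in
  \<open>\<gamma>\<^sub>n(G)\<close>. If \<open>\<gamma>\<^sub>n(G) \<noteq> Z(G)\<close> and \<open>var = p\<^sup>k\<close>, then some \<open>z \<in> Z(G) - \<gamma>\<^sub>n(G)\<close> has order dividing \<open>p\<^sup>k\<^sup>+\<^sup>1\<close>,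
  whence \<open>e \<le> k\<close>.\<close>

section \<open>Finite abelian p-groups\<close>

locale finite_p_group = group +
  fixes p :: nat
  assumes prime_p: "Factorial_Ring.prime p"
    and finite_carrier: "finite (carrier G)"
    and prime_power_order: "\<exists>k. order G = p ^ k"
begin

lemma prime_power_ord:
  assumes "x \<in> carrier G"
  shows "\<exists>e. ord x = p ^ e"
  using ord_dvd_group_order[OF assms] prime_power_order prime_p divides_primepow_nat by metis

lemma finite_p_group_subgroup:
  assumes "subgroup H G"
  shows "finite_p_group (G\<lparr>carrier := H\<rparr>) p"
proof -
  obtain k where k: "order G = p ^ k" using prime_power_order by blast
  have "card H dvd p ^ k" using lagrange[OF assms] k by (metis dvd_triv_right)
  then have "\<exists>j. card H = p ^ j" using prime_p divides_primepow_nat by metis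
  moreover have "finite H" using subgroup.subset[OF assms] finite_carrier finite_subset by blast
  ultimately show ?thesis using prime_p subgroup_imp_group[OF assms]
    by (simp add: finite_p_group_def finite_p_group_axioms_def order_def)
qed

lemma FactGroup_finite_p_group:
  assumes "N \<lhd> G"
  shows "finite_p_group (G Mod N) p"
proof -
  interpret N: normal N G by fact
  obtain k where k: "order G = p ^ k" using prime_power_order by blast
  have "card (rcosets N) * card N = order G" using lagrange[OF N.subgroup_axioms] .
  then have "card (rcosets N) dvd p ^ k" using k by (metis dvd_triv_left)
  then have "\<exists>j. card (rcosets N) = p ^ j" using prime_p divides_primepow_nat by metis
  then have "\<exists>j. order (G Mod N) = p ^ j" by (simp add: order_def FactGroup_def)
  moreover have "finite (carrier (G Mod N))" using finite_carrier by (simp add: carrier_FactGroup)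
  ultimately show ?thesis using prime_p N.factorgroup_is_group
    by (simp add: finite_p_group_def finite_p_group_axioms_def)
qed

end

locale finite_abelian_p_group = finite_p_group + comm_group

lemma (in comm_group) subgroup_adjoin:
  assumes "subgroup H G" "y \<in> carrier G"
  shows "subgroup {h \<otimes> y [^] (j::int) | h j. h \<in> H} G"
proof -
  have "{h \<otimes> y [^] (j::int) | h j. h \<in> H} = H <#> generate G {y}"
    using generate_pow[OF assms(2)] by (auto simp: set_mult_def)
  then show ?thesis
    using mult_subgroups[OF assms(1) generate_is_subgroup] assms(2) by simp
qed

section \<open>Splitting off a cyclic direct factor of maximal order\<close>

context finite_abelian_p_group
begin

text \<open>Orders of elements are powers of p and hence linearly ordered by divisibility, so the
  largest of them is a multiple of all others.\<close>

lemma max_order_element: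
  obtains x e where "x \<in> carrier G" "ord x = p ^ e" "\<And>a. a \<in> carrier G \<Longrightarrow> a [^] (p ^ e) = \<one>"
proof -
  have fin: "finite (ord ` carrier G)" using finite_carrier by simp
  have "Max (ord ` carrier G) \<in> ord ` carrier G" using fin carrier_not_empty by (intro Max_in) auto
  then obtain x where x: "x \<in> carrier G" "ord x = Max (ord ` carrier G)" by auto
  obtain e where e: "ord x = p ^ e" using prime_power_ord x by blast
  show thesis
  proof
    fix a assume a: "a \<in> carrier G"
    obtain d where d: "ord a = p ^ d" using prime_power_ord a by blast
    have "p ^ d \<le> p ^ e" using a d e x fin by (metis Max_ge image_eqI)
    then have "p ^ d dvd p ^ e"
      using prime_p prime_gt_1_nat power_le_imp_le_exp le_imp_power_dvd by metis
    then show "a [^] (p ^ e) = \<one>" using a d pow_eq_id by metis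
  qed (use x e in auto)
qed

lemma complement_exists:
  assumes x: "x \<in> carrier G" and ordx: "ord x = p ^ e"
    and e: "\<And>a. a \<in> carrier G \<Longrightarrow> a [^] (p ^ e) = \<one>"
  obtains H where "subgroup H G" "\<And>i::int. x [^] i \<in> H \<Longrightarrow> x [^] i = \<one>"
    "\<And>a. a \<in> carrier G \<Longrightarrow> \<exists>h\<in>H. \<exists>i::int. a = h \<otimes> x [^] i"
proof -
  \<comment> \<open>A subgroup \<open>H\<close> maximal among those meeting \<open>\<langle>x\<rangle>\<close> trivially works: given \<open>y\<close> outside
    \<open>K = H\<langle>x\<rangle>\<close> with \<open>y\<^sup>p \<in> K\<close>, maximality of the order of \<open>x\<close> allows to correct \<open>y\<close> by a power
    of \<open>x\<close> so that \<open>y\<^sup>p \<in> H\<close>, and then \<open>H\<langle>y\<rangle>\<close> is larger.\<close>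
  define F where "F = {H. subgroup H G \<and> (\<forall>i::int. x [^] i \<in> H \<longrightarrow> x [^] i = \<one>)}"
  have "F \<subseteq> Pow (carrier G)" using subgroup.subset by (auto simp: F_def)
  then have fin: "finite F" by (rule finite_subset) (simp add: finite_carrier)
  have "{\<one>} \<in> F" using triv_subgroup by (auto simp: F_def)
  then obtain H where H: "H \<in> F" and Hmax: "\<And>K. K \<in> F \<Longrightarrow> H \<subseteq> K \<Longrightarrow> K = H"
    using finite_has_maximal[OF fin] by blast
  have sH: "subgroup H G" and Hx: "\<And>i::int. x [^] i \<in> H \<Longrightarrow> x [^] i = \<one>" using H by (auto simp: F_def)
  define K where "K = {h \<otimes> x [^] (j::int) | h j. h \<in> H}"
  have sK: "subgroup K G" unfolding K_def by (rule subgroup_adjoin[OF sH x])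
  interpret H: subgroup H G by fact
  interpret K: subgroup K G by fact
  have HK: "H \<subseteq> K"
  proof
    fix h assume "h \<in> H"
    then have "h = h \<otimes> x [^] (0::int)" by auto
    then show "h \<in> K" unfolding K_def using \<open>h \<in> H\<close> by blast
  qed
  have xK: "x [^] (i::int) \<in> K" for i
  proof -
    have "x [^] i = \<one> \<otimes> x [^] i" using x by auto
    then show ?thesis unfolding K_def using H.one_closed by blast
  qed
  have "K = carrier G"
  proof (rule ccontr)
    assume "K \<noteq> carrier G"
    then obtain y where y: "y \<in> carrier G" "y \<notin> K" using K.subset by blast
    have "y [^] (p ^ e) \<in> K" using e y by auto
    \<comment> \<open>\<open>y1\<close> will be the last of the iterated p-th powers of
      \<open>y\<close> that lies outside \<open>K\<close>, so that its p-th power is in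
      \<open>K\<close>.\<close>
    define j where "j = (LEAST j. y [^] (p ^ j) \<in> K)"
    have jK: "y [^] (p ^ j) \<in> K" unfolding j_def by (rule LeastI) fact
    have "j \<noteq> 0" using jK y by (metis nat_pow_eone power_0)
    then obtain j' where j': "j = Suc j'" by (cases j) auto
    define y1 where "y1 = y [^] (p ^ j')"
    have y1: "y1 \<in> carrier G" "y1 \<notin> K" using y not_less_Least[of j' "\<lambda>j. y [^] (p ^ j) \<in> K"]
      by (auto simp: y1_def j_def[symmetric] j')
    have y1p: "y1 [^] p \<in> K" using jK y by (simp add: y1_def j' nat_pow_pow mult.commute)
    have "e \<noteq> 0"
    proof
      assume "e = 0"
      then have "y = \<one>" using e[OF y(1)] y by simp
      then show False using y by auto
    qed
    then obtain e' where e': "e = Suc e'" by (cases e) auto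
    obtain h i where hi: "h \<in> H" "y1 [^] p = h \<otimes> x [^] (i::int)" using y1p unfolding K_def by blast
    have hc: "h \<in> carrier G" using hi by auto
    \<comment> \<open>Raising y1^p to the power p^e' gives 1, so x^(i p^e') lies in \<open>H\<close>
      and is therefore trivial. As \<open>x\<close> has order p^e, this forces p to divide
      \<open>i\<close>.\<close>
    have "\<one> = (y1 [^] p) [^] (p ^ e')" using e[OF y1(1)] y1 by (simp add: nat_pow_pow e')
    also have "\<dots> = h [^] (p ^ e') \<otimes> (x [^] i) [^] (p ^ e')"
      using hi hc x nat_pow_distrib by simp
    also have "(x [^] i) [^] (p ^ e') = x [^] (i * int (p ^ e'))"
      using int_pow_pow[OF x, of i "int (p ^ e')"] int_pow_int by metis
    finally have "\<one> = h [^] (p ^ e') \<otimes> x [^] (i * int (p ^ e'))" .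
    then have "x [^] (i * int (p ^ e')) = inv (h [^] (p ^ e'))"
      using x hc by (metis int_pow_closed inv_equality inv_inv inv_closed nat_pow_closed)
    moreover have "inv (h [^] (p ^ e')) \<in> H"
      using subgroup_int_pow_closed[OF sH hi(1), of "int (p ^ e')"] H.m_inv_closed unfolding int_pow_int by blast
    ultimately have "x [^] (i * int (p ^ e')) = \<one>" using Hx by metis
    then have "int (p ^ e) dvd i * int (p ^ e')" using int_pow_eq_id[OF x] ordx by metis
    then have "int p dvd i" using prime_p prime_gt_0_nat[of p] by (simp add: e' )
    then obtain i' where i': "i = int p * i'" by (auto elim: dvdE)
    define y2 where "y2 = y1 \<otimes> x [^] (- i')"
    have y2c: "y2 \<in> carrier G" using y1 x by (auto simp: y2_def)
    have y2K: "y2 \<notin> K"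
    proof
      assume "y2 \<in> K"
      then have "y2 \<otimes> x [^] i' \<in> K" using xK by auto
      moreover have "y2 \<otimes> x [^] i' = y1" using y1 x by (simp add: y2_def m_assoc flip: int_pow_mult)
      ultimately show False using y1 by simp
    qed
    have y2p: "y2 [^] p = h"
    proof -
      have "y2 [^] p = y1 [^] p \<otimes> (x [^] (- i')) [^] (int p)"
        using y1 x by (simp add: y2_def nat_pow_distrib int_pow_int)
      also have "\<dots> = h \<otimes> (x [^] i \<otimes> x [^] (- i))"
        using hi hc x by (simp add: int_pow_pow i' m_assoc mult.commute)
      also have "\<dots> = h" using x hc by (simp flip: int_pow_mult)
      finally show ?thesis .
    qed
    define H' where "H' = {g \<otimes> y2 [^] (j::int) | g j. g \<in> H}"
    have sH': "subgroup H' G" unfolding H'_def by (rule subgroup_adjoin[OF sH y2c])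
    have HH': "H \<subseteq> H'"
    proof
      fix h assume "h \<in> H"
      then have "h = h \<otimes> y2 [^] (0::int)" by auto
      then show "h \<in> H'" unfolding H'_def using \<open>h \<in> H\<close> by blast
    qed
    have "y2 \<in> H'"
    proof -
      have "y2 = \<one> \<otimes> y2 [^] (1::int)" using y2c by auto
      then show ?thesis unfolding H'_def using H.one_closed by blast
    qed
    then have "H' \<notin> F" using Hmax[of H'] HH' y2K HK by auto
    then obtain l where l: "x [^] (l::int) \<in> H'" "x [^] l \<noteq> \<one>" using sH' by (auto simp: F_def)
    obtain g j where g: "g \<in> H" and gj: "x [^] l = g \<otimes> y2 [^] (j::int)" using l unfolding H'_def by blast
    have y2j: "y2 [^] (int p * m) \<in> H" for m
    proof -
      have "y2 [^] (int p * m) = h [^] m"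
        using y2p y2c by (metis int_pow_int int_pow_pow)
      then show ?thesis using subgroup_int_pow_closed[OF sH hi(1)] by simp
    qed
    show False
    proof (cases "int p dvd j")
      case True
      then have "x [^] l \<in> H" using y2j gj g by (auto elim!: dvdE)
      then show ?thesis using Hx l by blast
    next
      case False
      then have "coprime (int p) j" using prime_p by (simp add: prime_imp_coprime)
      \<comment> \<open>By Bezout, \<open>y2\<close> is a product of a power of y2^p, which lies in
        \<open>H\<close>, and a power of y2^j, which lies in \<open>K\<close>.\<close>
      then obtain u v where uv: "u * int p + v * j = 1" using bezout_int[of "int p" j] by auto
      have "y2 [^] j = inv g \<otimes> x [^] l" using gj g y2c H.mem_carrier
        by (simp add: m_assoc[symmetric])
      then have jK: "y2 [^] j \<in> K" using xK g HK H.m_inv_closed by (auto intro!: K.m_closed)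
      have "y2 = y2 [^] (int p * u) \<otimes> (y2 [^] j) [^] v"
        using uv y2c by (simp add: int_pow_pow mult.commute flip: int_pow_mult)
      also have "\<dots> \<in> K" using y2j HK subgroup_int_pow_closed[OF sK jK] by auto
      finally show False using y2K by simp
    qed
  qed
  then show thesis using that[of H] sH Hx unfolding K_def by blast
qed

text \<open>With a complement \<open>H\<close> of the powers of \<open>x\<close>, the map sending h
  x^i to z^i is well defined, since the order of \<open>z\<close> divides the order p^e of
  \<open>x\<close>. Its image is the cyclic group of powers of \<open>z\<close>, so \<open>B\<close>
  may be any group; later it is a non-abelian group of which the source is a quotient.\<close>

lemma hom_onto_root_of_one:
  assumes x: "x \<in> carrier G" and ordx: "ord x = p ^ e"
    and e: "\<And>a. a \<in> carrier G \<Longrightarrow> a [^] (p ^ e) = \<one>"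
    and B: "group B" and z: "z \<in> carrier B" "z [^]\<^bsub>B\<^esub> (p ^ e) = \<one>\<^bsub>B\<^esub>"
  obtains f where "f \<in> hom G B" "f x = z" "\<And>a. a \<in> carrier G \<Longrightarrow> \<exists>i::int. f a = z [^]\<^bsub>B\<^esub> i"
proof -
  interpret B: group B by fact
  obtain H where sH: "subgroup H G" and Hx: "\<And>i::int. x [^] i \<in> H \<Longrightarrow> x [^] i = \<one>"
    and dec: "\<And>a. a \<in> carrier G \<Longrightarrow> \<exists>h\<in>H. \<exists>i::int. a = h \<otimes> x [^] i"
    using complement_exists[OF x ordx e] by blast
  interpret H: subgroup H G by fact
  have "\<exists>i::int. \<exists>h\<in>H. a = h \<otimes> x [^] i" if "a \<in> carrier G" for a using dec[OF that] by blast
  \<comment> \<open>\<open>I a\<close> is one choice among many exponents; \<open>uniq\<close> shows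
    that z^(I a) does not depend on it.\<close>
  then obtain I :: "'a \<Rightarrow> int" where I: "\<And>a. a \<in> carrier G \<Longrightarrow> \<exists>h\<in>H. a = h \<otimes> x [^] I a" by metis
  have uniq: "z [^]\<^bsub>B\<^esub> i = z [^]\<^bsub>B\<^esub> j" if "h \<in> H" "h' \<in> H" "h \<otimes> x [^] i = h' \<otimes> x [^] j" for h h' and i j :: int
  proof -
    have c: "h \<in> carrier G" "h' \<in> carrier G" using that by auto
    have "x [^] i = inv h \<otimes> (h' \<otimes> x [^] j)" using that(3) c x by (metis inv_closed int_pow_closed inv_solve_left m_closed)
    then have "x [^] (i - j) = (inv h \<otimes> (h' \<otimes> x [^] j)) \<otimes> inv (x [^] j)" using x by (simp add: int_pow_diff)
    also have "\<dots> = inv h \<otimes> h'" using c x by (simp add: m_assoc)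
    finally have "x [^] (i - j) \<in> H" using that by auto
    then have "int (p ^ e) dvd i - j" using Hx int_pow_eq_id[OF x] ordx by metis
    moreover have "int (B.ord z) dvd int (p ^ e)" using z B.pow_eq_id int_dvd_int_iff by blast
    ultimately have "int (B.ord z) dvd i - j" using dvd_trans by blast
    then show ?thesis using B.int_pow_eq[OF z(1)] by (metis dvd_diff_commute)
  qed
  define f where "f a = z [^]\<^bsub>B\<^esub> I a" for a
  have f: "f (h \<otimes> x [^] i) = z [^]\<^bsub>B\<^esub> i" if "h \<in> H" for h and i :: int
    using I[of "h \<otimes> x [^] i"] uniq[OF that] that x unfolding f_def
    by (metis H.mem_carrier int_pow_closed m_closed)
  show thesis
  proof
    show "f \<in> hom G B"
    proof (rule homI)
      fix a b assume a: "a \<in> carrier G" and b: "b \<in> carrier G"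
      obtain h where h: "h \<in> H" "a = h \<otimes> x [^] I a" using I a by blast
      obtain g where g: "g \<in> H" "b = g \<otimes> x [^] I b" using I b by blast
      have "a \<otimes> b = (h \<otimes> x [^] I a) \<otimes> (g \<otimes> x [^] I b)" using h(2) g(2) by simp
      also have "\<dots> = (h \<otimes> g) \<otimes> (x [^] I a \<otimes> x [^] I b)"
        using h(1) g(1) x by (simp add: m_ac)
      also have "\<dots> = (h \<otimes> g) \<otimes> x [^] (I a + I b)" using x by (simp add: int_pow_mult)
      finally have "f (a \<otimes> b) = z [^]\<^bsub>B\<^esub> (I a + I b)" using f h g by auto
      then show "f (a \<otimes> b) = f a \<otimes>\<^bsub>B\<^esub> f b" using z by (simp add: f_def B.int_pow_mult)
    qed (use z in \<open>simp add: f_def\<close>)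
    show "f x = z" using f[of \<one> 1] x z by simp
  qed (auto simp: f_def)
qed

end

lemma (in finite_abelian_p_group) finite_abelian_p_group_subgroup:
  assumes "subgroup H G"
  shows "finite_abelian_p_group (G\<lparr>carrier := H\<rparr>) p"
proof -
  have "comm_group (G\<lparr>carrier := H\<rparr>)"
    using subgroup.mem_carrier[OF assms] m_comm
    by (intro group.group_comm_groupI[OF subgroup_imp_group[OF assms]]) auto
  then show ?thesis
    using finite_p_group_subgroup[OF assms] by (simp add: finite_abelian_p_group_def)
qed

section \<open>Existence of a cyclic decomposition\<close>

lemma product_group_pow:
  assumes "f \<in> extensional I"
  shows "f [^]\<^bsub>product_group I G\<^esub> (n::nat) = (\<lambda>i\<in>I. f i [^]\<^bsub>G i\<^esub> n)"
  by (induction n) (auto simp: restrict_def fun_eq_iff)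

abbreviation cyclic_product :: "nat \<Rightarrow> nat list \<Rightarrow> (nat \<Rightarrow> int) monoid" where
  "cyclic_product p ns \<equiv> product_group {..<length ns} (\<lambda>i. integer_mod_group (p ^ (ns ! i)))"

text \<open>If \<open>g\<close> is an isomorphism from the product for \<open>ns\<close> onto
  \<open>H\<close>, then the isomorphism from the product for \<open>m # ns\<close> maps f to g(tail
  of f) times x^(f 0). Injectivity uses that powers of \<open>x\<close> meet \<open>H\<close>
  trivially, surjectivity uses \<open>dec\<close>.\<close>

lemma (in finite_abelian_p_group) cyclic_type_Cons:
  assumes x: "x \<in> carrier G" and ordx: "ord x = p ^ m" and m: "0 < m"
    and sH: "subgroup H G" and Hx: "\<And>i::int. x [^] i \<in> H \<Longrightarrow> x [^] i = \<one>"
    and dec: "\<And>a. a \<in> carrier G \<Longrightarrow> \<exists>h\<in>H. \<exists>i::int. a = h \<otimes> x [^] i"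
    and type: "cyclic_type p (G\<lparr>carrier := H\<rparr>) ns" and le: "\<And>n. n \<in> set ns \<Longrightarrow> n \<le> m"
  shows "cyclic_type p G (m # ns)"
proof -
  interpret H: subgroup H G by fact
  have p0: "p > 0" using prime_p prime_gt_0_nat by blast
  define P where "P = cyclic_product p ns"
  define Q where "Q = cyclic_product p (m # ns)"
  have P: "group P" and Q: "group Q" by (auto simp: P_def Q_def)
  \<comment> \<open>As p is positive, \<open>integer_mod_group\<close> consists of the least
    nonnegative residues, so that elements of \<open>P\<close> and \<open>Q\<close> are bounded
    integer functions, extensional on the index set.\<close>
  have Pc: "t \<in> carrier P \<longleftrightarrow>
      t \<in> extensional {..<length ns} \<and> (\<forall>i<length ns. 0 \<le> t i \<and> t i < int (p ^ (ns ! i)))" for t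
    using p0 by (auto simp: P_def PiE_iff carrier_integer_mod_group)
  have Qc: "f \<in> carrier Q \<longleftrightarrow> f \<in> extensional {..<Suc (length ns)} \<and>
      0 \<le> f 0 \<and> f 0 < int (p ^ m) \<and> (\<forall>i<length ns. 0 \<le> f (Suc i) \<and> f (Suc i) < int (p ^ (ns ! i)))" for f
  proof -
    have split: "(\<forall>i\<in>{..<Suc k}. R i) \<longleftrightarrow> R 0 \<and> (\<forall>i<k. R (Suc i))" for k and R :: "nat \<Rightarrow> bool"
      by (auto simp: less_Suc_eq_0_disj)
    show ?thesis using p0 by (auto simp: Q_def PiE_iff carrier_integer_mod_group split)
  qed
  interpret GH: group "G\<lparr>carrier := H\<rparr>" using subgroup_imp_group[OF sH] .
  have "P \<cong> G\<lparr>carrier := H\<rparr>" using type GH.iso_sym unfolding cyclic_type_def P_def by blast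
  then obtain g where g: "g \<in> iso P (G\<lparr>carrier := H\<rparr>)" unfolding is_iso_def by blast
  then have gbij: "bij_betw g (carrier P) H" by (simp add: iso_def)
  interpret g: group_hom P "G\<lparr>carrier := H\<rparr>" g
    using g P GH.is_group by (simp add: group_hom_def group_hom_axioms_def iso_def)
  define tl' where "tl' f = (\<lambda>i\<in>{..<length ns}. f (Suc i))" for f :: "nat \<Rightarrow> int"
  define \<phi> where "\<phi> f = g (tl' f) \<otimes> x [^] f 0" for f
  have tlc: "tl' f \<in> carrier P" if "f \<in> carrier Q" for f
    using that unfolding Pc Qc tl'_def by auto
  have gH: "g t \<in> H" if "t \<in> carrier P" for t
    using bij_betw_apply[OF gbij that] .
  have xmod: "x [^] (i mod int (p ^ m)) = x [^] i" for i :: int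
    unfolding int_pow_eq[OF x] ordx by (metis dvd_minus_mod)
  have hom: "\<phi> \<in> hom Q G"
  proof (rule homI)
    fix f assume "f \<in> carrier Q" 
    then have "g (tl' f) \<in> carrier G" using gH[OF tlc] by auto
    then show "\<phi> f \<in> carrier G" using x unfolding \<phi>_def by auto
  next
    fix f f' assume f: "f \<in> carrier Q" "f' \<in> carrier Q"
    have "tl' (f \<otimes>\<^bsub>Q\<^esub> f') = tl' f \<otimes>\<^bsub>P\<^esub> tl' f'"
      unfolding P_def Q_def by (auto simp: tl'_def fun_eq_iff)
    then have 1: "g (tl' (f \<otimes>\<^bsub>Q\<^esub> f')) = g (tl' f) \<otimes> g (tl' f')" using g.hom_mult[OF tlc tlc] f by simp
    have "(f \<otimes>\<^bsub>Q\<^esub> f') 0 = (f 0 + f' 0) mod int (p ^ m)" by (simp add: Q_def)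
    then have 2: "x [^] (f \<otimes>\<^bsub>Q\<^esub> f') 0 = x [^] f 0 \<otimes> x [^] f' 0" using xmod x int_pow_mult by metis
    have "g (tl' f) \<in> carrier G" "g (tl' f') \<in> carrier G" using gH tlc f by auto
    then show "\<phi> (f \<otimes>\<^bsub>Q\<^esub> f') = \<phi> f \<otimes> \<phi> f'" using 1 2 x unfolding \<phi>_def by (simp add: m_ac)
  qed
  interpret \<phi>: group_hom Q G \<phi> using hom Q is_group by (simp add: group_hom_def group_hom_axioms_def)
  have "\<phi> \<in> iso Q G" unfolding \<phi>.iso_iff
  proof (intro conjI ballI impI)
    show "carrier G \<subseteq> \<phi> ` carrier Q"
    proof
      fix a assume "a \<in> carrier G"
      then obtain h i where h: "h \<in> H" and a: "a = h \<otimes> x [^] (i::int)" using dec by blast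
      obtain t where t: "t \<in> carrier P" "h = g t" using h gbij unfolding bij_betw_def by blast
      define f where "f = (\<lambda>j\<in>{..<Suc (length ns)}. case j of 0 \<Rightarrow> i mod int (p ^ m) | Suc j \<Rightarrow> t j)"
      have f: "f \<in> carrier Q" using t p0 unfolding Qc Pc
        by (auto simp: f_def)
      have "tl' f = t" using t(1) unfolding Pc by (auto simp: tl'_def f_def fun_eq_iff extensional_def)
      moreover have "f 0 = i mod int (p ^ m)" by (simp add: f_def)
      ultimately have "\<phi> f = a" unfolding \<phi>_def using xmod a t by metis
      then show "a \<in> \<phi> ` carrier Q" using f by blast
    qed
  next
    fix f assume f: "f \<in> carrier Q" and "\<phi> f = \<one>"
    then have 1: "g (tl' f) \<otimes> x [^] f 0 = \<one>" by (simp add: \<phi>_def)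
    have gt: "g (tl' f) \<in> H" using gH tlc f by blast
    then have "x [^] f 0 = inv (g (tl' f))" using 1 x
      by (metis H.mem_carrier int_pow_closed inv_equality inv_inv)
    then have x1: "x [^] f 0 = \<one>" using Hx gt H.m_inv_closed by metis
    then have "g (tl' f) = \<one>" using 1 gt by auto
    moreover have "g (\<one>\<^bsub>P\<^esub>) = \<one>" using g.hom_one by simp
    ultimately have tl: "tl' f = \<one>\<^bsub>P\<^esub>" using gbij tlc[OF f] group.is_monoid[OF P] monoid.one_closed
      by (metis bij_betw_def inj_onD)
    have "int (p ^ m) dvd f 0" using x1 int_pow_eq_id[OF x] ordx by metis
    then have f0: "f 0 = 0" using f unfolding Qc using zdvd_not_zless[of "f 0" "int (p ^ m)"] by linarith
    show "f = \<one>\<^bsub>Q\<^esub>"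
    proof
      fix i show "f i = \<one>\<^bsub>Q\<^esub> i"
      proof (cases i)
        case 0 then show ?thesis using f0 by (simp add: Q_def)
      next
        case (Suc j)
        show ?thesis
        proof (cases "j < length ns")
          case True
          then have "f i = tl' f j" using Suc by (simp add: tl'_def)
          then show ?thesis using True Suc tl by (simp add: P_def Q_def)
        next
          case False
          then show ?thesis using f Suc unfolding Qc by (auto simp: extensional_def Q_def)
        qed
      qed
    qed
  qed
  then have "Q \<cong> G" unfolding is_iso_def by blast
  then have "G \<cong> Q" using group.iso_sym[OF Q] by blast
  then show ?thesis using type m le unfolding cyclic_type_def Q_def by auto
qed

text \<open>Induction on the order: an element of maximal order p^m splits off, and the complement
  \<open>H\<close> is smaller. The bound on the entries is carried along because it shows that no
  entry for \<open>H\<close> exceeds \<open>m\<close>, which keeps the list nonincreasing. The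
  generating set, made of one element per factor, is needed for the rank.\<close>

lemma cyclic_type_exists:
  fixes G :: "('a, 'b) monoid_scheme"
  assumes "finite_abelian_p_group G p"
  obtains ns where "cyclic_type p G ns"
    "\<And>e. (\<And>a. a \<in> carrier G \<Longrightarrow> a [^]\<^bsub>G\<^esub> (p ^ e) = \<one>\<^bsub>G\<^esub>) \<Longrightarrow> \<forall>n\<in>set ns. n \<le> e"
    "\<exists>S\<subseteq>carrier G. finite S \<and> card S \<le> length ns \<and> generate G S = carrier G"
proof -
  have "\<exists>ns. cyclic_type p G ns \<and>
    (\<forall>e. (\<forall>a\<in>carrier G. a [^]\<^bsub>G\<^esub> (p ^ e) = \<one>\<^bsub>G\<^esub>) \<longrightarrow> (\<forall>n\<in>set ns. n \<le> e)) \<and>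
    (\<exists>S\<subseteq>carrier G. finite S \<and> card S \<le> length ns \<and> generate G S = carrier G)"
    using assms
  proof (induction "card (carrier G)" arbitrary: G rule: less_induct)
    case less
    interpret finite_abelian_p_group G p by fact
    show ?case
    proof (cases "carrier G = {\<one>\<^bsub>G\<^esub>}")
      case True
      \<comment> \<open>The product over the empty index set has the everywhere
        \<open>undefined\<close> function as its only element.\<close>
      then have "(\<lambda>_ _. undefined) \<in> iso G (cyclic_product p [])"
        by (auto simp: iso_def hom_def bij_betw_def inj_on_def fun_eq_iff)
      then have "G \<cong> cyclic_product p []" by (rule is_isoI)
      then have "cyclic_type p G []" unfolding cyclic_type_def by simp
      moreover have "generate G {} = carrier G" using generate_empty True by simp
      ultimately show ?thesis by (intro exI[of _ "[]"]) auto
    next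
      case False
      obtain x m where x: "x \<in> carrier G" "ord x = p ^ m"
        and max: "\<And>a. a \<in> carrier G \<Longrightarrow> a [^]\<^bsub>G\<^esub> (p ^ m) = \<one>\<^bsub>G\<^esub>"
        using max_order_element by blast
      have m: "m > 0"
      proof (rule ccontr)
        assume "\<not> 0 < m"
        then have "a = \<one>\<^bsub>G\<^esub>" if "a \<in> carrier G" for a using max[OF that] that by simp
        then show False using False by blast
      qed
      obtain H where H: "subgroup H G" and Hx: "\<And>i::int. x [^]\<^bsub>G\<^esub> i \<in> H \<Longrightarrow> x [^]\<^bsub>G\<^esub> i = \<one>\<^bsub>G\<^esub>"
        and dec: "\<And>a. a \<in> carrier G \<Longrightarrow> \<exists>h\<in>H. \<exists>i::int. a = h \<otimes>\<^bsub>G\<^esub> x [^]\<^bsub>G\<^esub> i"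
        using complement_exists[OF x max] by blast
      interpret H: subgroup H G by fact
      have p1: "p > 1" using prime_p prime_gt_1_nat by blast
      \<comment> \<open>This makes \<open>H\<close> a proper subgroup, to which the induction
        hypothesis applies.\<close>
      have "x \<notin> H"
      proof
        assume "x \<in> H"
        then have "x = \<one>\<^bsub>G\<^esub>" using Hx[of 1] x by simp
        then have "p ^ m = 1" using x by simp
        then show False using p1 m by simp
      qed
      then have "card H < card (carrier G)" using x H.subset finite_carrier
        by (metis psubsetI psubset_card_mono)
      moreover have "finite_abelian_p_group (G\<lparr>carrier := H\<rparr>) p"
        using finite_abelian_p_group_subgroup[OF H] .
      ultimately obtain ns S where ns: "cyclic_type p (G\<lparr>carrier := H\<rparr>) ns"
        and nse: "\<And>e. (\<forall>a\<in>H. a [^]\<^bsub>G\<^esub> (p ^ e) = \<one>\<^bsub>G\<^esub>) \<Longrightarrow> (\<forall>n\<in>set ns. n \<le> e)"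
        and S: "S \<subseteq> H" "finite S" "card S \<le> length ns" "generate (G\<lparr>carrier := H\<rparr>) S = H"
        using less.hyps[of "G\<lparr>carrier := H\<rparr>"] by (simp flip: nat_pow_consistent) blast
      have "cyclic_type p G (m # ns)"
        using cyclic_type_Cons[OF x m H Hx dec ns] nse[of m] max H.mem_carrier by blast
      moreover have "\<forall>n\<in>set (m # ns). n \<le> e" if e: "\<forall>a\<in>carrier G. a [^]\<^bsub>G\<^esub> (p ^ e) = \<one>\<^bsub>G\<^esub>" for e
      proof -
        have "p ^ m dvd p ^ e" using e x pow_eq_id by metis
        then have "m \<le> e" using p1 power_dvd_imp_le by blast
        then show ?thesis using nse[of e] e H.mem_carrier by auto
      qed
      moreover have "generate G (insert x S) = carrier G"
      proof
        have SG: "insert x S \<subseteq> carrier G" using x S H.subset by auto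
        interpret X: subgroup "generate G (insert x S)" G using generate_is_subgroup[OF SG] .
        show "generate G (insert x S) \<subseteq> carrier G" by (rule X.subset)
        have "H = generate G S" using S generate_consistent[OF S(1) H] by simp
        then have HX: "H \<subseteq> generate G (insert x S)" using mono_generate[of S "insert x S"] by blast
        have "x \<in> generate G (insert x S)" by (simp add: generate.incl)
        then have xX: "x [^]\<^bsub>G\<^esub> (i::int) \<in> generate G (insert x S)" for i
          using subgroup_int_pow_closed[OF X.subgroup_axioms] by blast
        show "carrier G \<subseteq> generate G (insert x S)" using dec HX xX X.m_closed by blast
      qed
      moreover have "card (insert x S) \<le> length (m # ns)" using S card_insert_le_m1 by (simp add: card_insert_if)
      moreover have "insert x S \<subseteq> carrier G" "finite (insert x S)" using S x H.subset by auto
      ultimately show ?thesis by blast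
    qed
  qed
  then show thesis using that by blast
qed

section \<open>Invariants of the cyclic type\<close>

text \<open>\<open>power_socle G p k\<close> is the subgroup of elements of order dividing \<open>p\<close> in the \<open>p\<^sup>k\<close>-th powers. Its order is
  \<open>p\<close> to the number of cyclic factors of order greater than \<open>p\<^sup>k\<close>; as it is monotone in the group,
  it recovers the cyclic type and compares the types of \<open>A \<subseteq> B\<close> entrywise.\<close>

definition power_socle :: "('a, 'b) monoid_scheme \<Rightarrow> nat \<Rightarrow> nat \<Rightarrow> 'a set" where
  "power_socle G p k = {x [^]\<^bsub>G\<^esub> (p ^ k) | x. x \<in> carrier G \<and> x [^]\<^bsub>G\<^esub> (p ^ Suc k) = \<one>\<^bsub>G\<^esub>}"

section \<open>Power socles under isomorphisms, in products and in cyclic groups\<close>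

lemma power_socleI:
  assumes "x \<in> carrier G" "x [^]\<^bsub>G\<^esub> (p ^ Suc k) = \<one>\<^bsub>G\<^esub>" "y = x [^]\<^bsub>G\<^esub> (p ^ k)"
  shows "y \<in> power_socle G p k"
  unfolding power_socle_def by (rule CollectI, rule exI[of _ x], intro conjI assms)

lemma power_socleE:
  assumes "y \<in> power_socle G p k"
  obtains x where "x \<in> carrier G" "x [^]\<^bsub>G\<^esub> (p ^ Suc k) = \<one>\<^bsub>G\<^esub>" "y = x [^]\<^bsub>G\<^esub> (p ^ k)"
proof -
  have "\<exists>x. y = x [^]\<^bsub>G\<^esub> (p ^ k) \<and> x \<in> carrier G \<and> x [^]\<^bsub>G\<^esub> (p ^ Suc k) = \<one>\<^bsub>G\<^esub>"
    using assms unfolding power_socle_def by (rule CollectD)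
  then show thesis using that by (elim exE conjE)
qed

lemma power_socle_iso:
  assumes "group G" "group H" "\<phi> \<in> iso G H"
  shows "\<phi> ` power_socle G p k = power_socle H p k"
proof -
  interpret group_hom G H \<phi> using assms by (simp add: group_hom_def group_hom_axioms_def iso_def)
  have bij: "bij_betw \<phi> (carrier G) (carrier H)" using assms(3) by (simp add: iso_def)
  have one: "x [^]\<^bsub>G\<^esub> n = \<one>\<^bsub>G\<^esub> \<longleftrightarrow> \<phi> x [^]\<^bsub>H\<^esub> n = \<one>\<^bsub>H\<^esub>" if "x \<in> carrier G" for x and n :: nat
    using inj_on_eq_iff[OF bij_betw_imp_inj_on[OF bij] G.nat_pow_closed[OF that, of n] G.one_closed]
    by (simp only: hom_nat_pow[OF that] hom_one)
  show ?thesis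
  proof
    show "\<phi> ` power_socle G p k \<subseteq> power_socle H p k"
    proof
      fix y assume "y \<in> \<phi> ` power_socle G p k"
      then obtain w where w: "w \<in> power_socle G p k" "y = \<phi> w" by blast
      obtain x where x: "x \<in> carrier G" "x [^]\<^bsub>G\<^esub> (p ^ Suc k) = \<one>\<^bsub>G\<^esub>" "w = x [^]\<^bsub>G\<^esub> (p ^ k)"
        using w(1) by (rule power_socleE)
      have "\<phi> x [^]\<^bsub>H\<^esub> (p ^ Suc k) = \<one>\<^bsub>H\<^esub>" using one[OF x(1)] x(2) by (rule iffD1)
      moreover have "y = \<phi> x [^]\<^bsub>H\<^esub> (p ^ k)" using w(2) x(3) hom_nat_pow[OF x(1)] by simp
      ultimately show "y \<in> power_socle H p k" by (rule power_socleI[OF hom_closed[OF x(1)]])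
    qed
    show "power_socle H p k \<subseteq> \<phi> ` power_socle G p k"
    proof
      fix y assume "y \<in> power_socle H p k"
      then obtain z where z: "z \<in> carrier H" "z [^]\<^bsub>H\<^esub> (p ^ Suc k) = \<one>\<^bsub>H\<^esub>" "y = z [^]\<^bsub>H\<^esub> (p ^ k)"
        by (rule power_socleE)
      obtain x where x: "x \<in> carrier G" "\<phi> x = z" 
        using z(1) unfolding bij_betw_imp_surj_on[OF bij, symmetric] by (elim imageE) simp
      have "x [^]\<^bsub>G\<^esub> (p ^ Suc k) = \<one>\<^bsub>G\<^esub>"
        using one[OF x(1), of "p ^ Suc k"] z(2) unfolding x(2) by (rule iffD2)
      then have "x [^]\<^bsub>G\<^esub> (p ^ k) \<in> power_socle G p k"
        by (rule power_socleI[OF x(1) _ refl])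
      moreover have "y = \<phi> (x [^]\<^bsub>G\<^esub> (p ^ k))" using x(2) z(3) hom_nat_pow[OF x(1)] by simp
      ultimately show "y \<in> \<phi> ` power_socle G p k" by blast
    qed
  qed
qed

lemma power_socle_subset: "group G \<Longrightarrow> power_socle G p k \<subseteq> carrier G"
  using monoid.nat_pow_closed[OF group.is_monoid] by (fastforce elim: power_socleE)

lemma power_socle_product_group:
  "power_socle (product_group I G) p k = (\<Pi>\<^sub>E i\<in>I. power_socle (G i) p k)" (is "?L = ?R")
proof
  show "?L \<subseteq> ?R"
  proof
    fix y assume "y \<in> ?L"
    then obtain x where x: "x \<in> carrier (product_group I G)"
      "x [^]\<^bsub>product_group I G\<^esub> (p ^ Suc k) = \<one>\<^bsub>product_group I G\<^esub>"
      "y = x [^]\<^bsub>product_group I G\<^esub> (p ^ k)" by (rule power_socleE)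
    have xi: "x i \<in> carrier (G i)" if "i \<in> I" for i using x(1) that by (auto simp only: carrier_product_group PiE_iff)
    have ext: "x \<in> extensional I" using x(1) by (simp only: carrier_product_group PiE_def IntD2)
    have "(\<lambda>i\<in>I. x i [^]\<^bsub>G i\<^esub> (p ^ Suc k)) = (\<lambda>i\<in>I. \<one>\<^bsub>G i\<^esub>)"
      using x(2) unfolding product_group_pow[OF ext] one_product_group .
    then have "x i [^]\<^bsub>G i\<^esub> (p ^ Suc k) = \<one>\<^bsub>G i\<^esub>" if "i \<in> I" for i
      using fun_cong[where x = i] that by (fastforce simp only: restrict_apply' dest: fun_cong[where x = i])
    moreover have "y = (\<lambda>i\<in>I. x i [^]\<^bsub>G i\<^esub> (p ^ k))" using x(3) product_group_pow[OF ext] by simp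
    ultimately show "y \<in> ?R" using power_socleI[OF xi _ refl] by auto
  qed
  show "?R \<subseteq> ?L"
  proof
    fix y assume y: "y \<in> ?R"
    then have "\<forall>i\<in>I. \<exists>x. x \<in> carrier (G i) \<and> x [^]\<^bsub>G i\<^esub> (p ^ Suc k) = \<one>\<^bsub>G i\<^esub> \<and> y i = x [^]\<^bsub>G i\<^esub> (p ^ k)"
      by (blast dest: PiE_mem elim: power_socleE)
    from bchoice[OF this] obtain x where x: "\<And>i. i \<in> I \<Longrightarrow> x i \<in> carrier (G i) \<and> x i [^]\<^bsub>G i\<^esub> (p ^ Suc k) = \<one>\<^bsub>G i\<^esub> \<and> y i = x i [^]\<^bsub>G i\<^esub> (p ^ k)"
      by blast
    let ?x = "restrict x I"
    have ext: "?x \<in> extensional I" by simp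
    have "?x \<in> carrier (product_group I G)" using x by simp
    moreover have "?x [^]\<^bsub>product_group I G\<^esub> (p ^ Suc k) = \<one>\<^bsub>product_group I G\<^esub>"
      unfolding product_group_pow[OF ext] one_product_group using x by (auto simp: restrict_def)
    moreover have "y = ?x [^]\<^bsub>product_group I G\<^esub> (p ^ k)"
      unfolding product_group_pow[OF ext] using x y by (auto simp: restrict_def PiE_iff extensional_def)
    ultimately show "y \<in> ?L" by (rule power_socleI)
  qed
qed

text \<open>Powers are multiples here. For n = k + d + 1 the condition p^(k+1) x = 0 modulo p^n
  means that p^d divides x, so the elements p^k x are the p multiples of p^(n-1). For k at least n
  multiplication by p^k is zero.\<close>

lemma card_power_socle_integer_mod_group:
  assumes p: "p > (0::nat)"
  shows "card (power_socle (integer_mod_group (p ^ n)) p k) = (if k < n then p else 1)"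
proof (cases "k < n")
  case True
  then obtain d where n: "n = Suc (k + d)" using less_imp_Suc_add by blast
  define q :: int where "q = int p"
  have q: "q > 0" using p by (simp add: q_def)
  have S: "power_socle (integer_mod_group (p ^ n)) p k =
      {q ^ k * x mod q ^ n | x. 0 \<le> x \<and> x < q ^ n \<and> q ^ Suc k * x mod q ^ n = 0}"
    unfolding power_socle_def using p by (auto simp: carrier_integer_mod_group q_def)
  have "\<dots> = (\<lambda>y. q ^ (k + d) * y) ` {0..<q}"
  proof
    show "{q ^ k * x mod q ^ n | x. 0 \<le> x \<and> x < q ^ n \<and> q ^ Suc k * x mod q ^ n = 0} \<subseteq> (\<lambda>y. q ^ (k + d) * y) ` {0..<q}"
    proof
      fix w assume "w \<in> {q ^ k * x mod q ^ n | x. 0 \<le> x \<and> x < q ^ n \<and> q ^ Suc k * x mod q ^ n = 0}"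
      then obtain x where w: "w = q ^ k * x mod q ^ n" and "q ^ n dvd q ^ Suc k * x" by auto
      moreover have "q ^ n = q ^ Suc k * q ^ d" by (simp add: n power_add)
      ultimately have "q ^ d dvd x" using q by simp
      then obtain y where y: "x = q ^ d * y" by (auto elim: dvdE)
      have "q ^ k * (q ^ d * y) = q ^ (k + d) * y" by (simp add: power_add)
      moreover have "q ^ n = q ^ (k + d) * q" by (simp add: n)
      ultimately have "w = (q ^ (k + d) * y) mod (q ^ (k + d) * q)" unfolding w y by (simp only:)
      then have "w = q ^ (k + d) * (y mod q)" unfolding mult_mod_right .
      then show "w \<in> (\<lambda>y. q ^ (k + d) * y) ` {0..<q}" using q by simp
    qed
    show "(\<lambda>y. q ^ (k + d) * y) ` {0..<q} \<subseteq> {q ^ k * x mod q ^ n | x. 0 \<le> x \<and> x < q ^ n \<and> q ^ Suc k * x mod q ^ n = 0}"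
    proof
      fix w assume "w \<in> (\<lambda>y. q ^ (k + d) * y) ` {0..<q}"
      then obtain y where y: "0 \<le> y" "y < q" and w: "w = q ^ (k + d) * y" by auto
      have n': "q ^ n = q ^ (k + d) * q" by (simp add: n)
      have wn: "w < q ^ n" "0 \<le> w" unfolding w n' using y q by simp_all
      have eq: "w = q ^ k * (q ^ d * y)" by (simp add: w power_add)
      have "1 \<le> q ^ k" using q by simp
      then have "q ^ d * y \<le> w" unfolding eq using y q mult_right_mono[of 1 "q ^ k" "q ^ d * y"] by simp
      then have "q ^ d * y < q ^ n" using wn by linarith
      moreover have "q ^ Suc k * (q ^ d * y) mod q ^ n = 0" by (simp add: n power_add)
      moreover have "w = q ^ k * (q ^ d * y) mod q ^ n" unfolding eq[symmetric] using wn by simp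
      moreover have "0 \<le> q ^ d * y" using q y by simp
      ultimately show "w \<in> {q ^ k * x mod q ^ n | x. 0 \<le> x \<and> x < q ^ n \<and> q ^ Suc k * x mod q ^ n = 0}"
        by (intro CollectI exI[of _ "q ^ d * y"] conjI)
    qed
  qed
  moreover have "card ((\<lambda>y. q ^ (k + d) * y) ` {0..<q}) = p"
    using q by (subst card_image) (auto simp: inj_on_def q_def)
  ultimately show ?thesis using True S by simp
next
  case False
  then obtain d where k: "k = n + d" using le_Suc_ex not_less by blast
  have "power_socle (integer_mod_group (p ^ n)) p k = {0}"
  proof
    show "power_socle (integer_mod_group (p ^ n)) p k \<subseteq> {0}"
      by (auto simp: k power_add elim!: power_socleE)
    have "(0::int) = 0 [^]\<^bsub>integer_mod_group (p ^ n)\<^esub> (p ^ k)" by simp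
    then show "{0} \<subseteq> power_socle (integer_mod_group (p ^ n)) p k"
      by (auto intro!: power_socleI[of 0])
  qed
  then show ?thesis using False by simp
qed

section \<open>The cyclic type is determined by the orders of the power socles\<close>

lemma initial_segment_eq_lessThan:
  fixes S :: "nat set"
  assumes "finite S" "\<And>i j. i \<in> S \<Longrightarrow> j \<le> i \<Longrightarrow> j \<in> S"
  shows "S = {..<card S}"
proof (rule card_subset_eq)
  show "S \<subseteq> {..<card S}"
  proof
    fix i assume "i \<in> S"
    then have "{..i} \<subseteq> S" using assms(2) by auto
    then have "card {..i} \<le> card S" using assms(1) card_mono by blast
    then show "i \<in> {..<card S}" by simp
  qed
qed auto

text \<open>Each cyclic factor contributes p or 1, so the socle has order p^(card S), where
  \<open>S\<close> is the set of positions with entry greater than \<open>k\<close>. As the list is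
  nonincreasing, \<open>S\<close> is an initial segment, and membership of \<open>i\<close> becomes
  i < card S. All comparisons of cyclic types go through this equivalence.\<close>

lemma cyclic_type_nth_iff:
  assumes G: "group G" and p: "Factorial_Ring.prime p" and type: "cyclic_type p G ns"
  shows "i < length ns \<and> k < ns ! i \<longleftrightarrow> p ^ i < card (power_socle G p k)"
proof -
  have p0: "p > 0" and p1: "p > 1" using p prime_gt_0_nat prime_gt_1_nat by blast+
  define S where "S = {i. i < length ns \<and> k < ns ! i}"
  have "finite S" by (simp add: S_def)
  obtain \<phi> where \<phi>: "\<phi> \<in> iso G (cyclic_product p ns)"
    using type unfolding cyclic_type_def is_iso_def by blast
  have P: "group (cyclic_product p ns)" by simp
  have "bij_betw \<phi> (carrier G) (carrier (cyclic_product p ns))"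
    using \<phi> unfolding iso_def by blast
  then have inj: "inj_on \<phi> (power_socle G p k)"
    by (rule inj_on_subset[OF bij_betw_imp_inj_on power_socle_subset[OF G]])
  have "card (power_socle G p k) = card (power_socle (cyclic_product p ns) p k)"
    unfolding power_socle_iso[OF G P \<phi>, symmetric] by (rule card_image[OF inj, symmetric])
  also have "\<dots> = (\<Prod>i<length ns. if k < ns ! i then p else 1)"
    unfolding power_socle_product_group card_PiE[OF finite_lessThan]
    by (simp only: card_power_socle_integer_mod_group[OF p0])
  also have "\<dots> = (\<Prod>i\<in>S. p)"
    unfolding S_def by (subst prod.inter_filter[symmetric]) (auto intro: prod.cong)
  also have "\<dots> = p ^ card S" by simp
  finally have card: "card (power_socle G p k) = p ^ card S" .
  have "j \<in> S" if "i \<in> S" "j \<le> i" for i j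
  proof -
    have "ns ! i \<le> ns ! j" using type that sorted_wrt_nth_less[of "(\<ge>)" ns j i]
      unfolding cyclic_type_def S_def by (cases "j = i") auto
    then show ?thesis using that unfolding S_def by auto
  qed
  then have "S = {..<card S}" using initial_segment_eq_lessThan \<open>finite S\<close> by blast
  then have "i \<in> S \<longleftrightarrow> i < card S" by blast
  then show ?thesis using card p1 unfolding S_def by simp
qed

text \<open>The case k = 0 of the previous criterion, as all entries are positive.\<close>

lemma cyclic_type_length_iff:
  assumes G: "group G" and p: "Factorial_Ring.prime p" and type: "cyclic_type p G ns"
  shows "i < length ns \<longleftrightarrow> p ^ i < card (power_socle G p 0)"
proof -
  have "0 < ns ! i" if "i < length ns"
    using type nth_mem[OF that] unfolding cyclic_type_def by blast
  then show ?thesis using cyclic_type_nth_iff[OF assms, of i 0] by blast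
qed

text \<open>The preceding criteria read off length and entries from cardinalities that do not
  mention the list.\<close>

lemma cyclic_type_unique:
  assumes G: "group G" and p: "Factorial_Ring.prime p"
    and ns: "cyclic_type p G ns" and ms: "cyclic_type p G ms"
  shows "ns = ms"
proof -
  have "i < length ns \<longleftrightarrow> i < length ms" for i
    using cyclic_type_length_iff[OF G p ns] cyclic_type_length_iff[OF G p ms] by blast
  then have len: "length ns = length ms" by (metis linorder_less_linear less_irrefl)
  have "k < ns ! i \<longleftrightarrow> k < ms ! i" if "i < length ns" for i k
    using cyclic_type_nth_iff[OF G p ns, of i k] cyclic_type_nth_iff[OF G p ms, of i k] that len by auto
  then show ?thesis using len by (intro nth_equalityI) (auto, metis linorder_less_linear less_irrefl)
qed

section \<open>The rank is the length of the cyclic type\<close>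

context finite_abelian_p_group
begin

text \<open>Adjoining a generator \<open>s\<close> to a subgroup that contains s^p multiplies the
  order by at most p. In the application \<open>P\<close> is the subgroup of p-th powers.\<close>

lemma card_generate_le:
  assumes "subgroup P G" "\<And>x. x \<in> carrier G \<Longrightarrow> x [^] p \<in> P"
    and "finite S" "S \<subseteq> carrier G"
  shows "card (generate G (S \<union> P)) \<le> p ^ card S * card P"
  using assms(3,4)
proof (induction S rule: finite_induct)
  case empty
  have "generate G P = P" using generate_subgroup_incl[OF subset_refl assms(1)] generate.incl by auto
  then show ?case by simp
next
  case (insert s S)
  have p0: "p > 0" using prime_p prime_gt_0_nat by blast
  define H where "H = generate G (S \<union> P)"
  have SP: "S \<union> P \<subseteq> carrier G" using insert.prems subgroup.subset[OF assms(1)] by auto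
  have sH: "subgroup H G" unfolding H_def by (rule generate_is_subgroup[OF SP])
  interpret H: subgroup H G by fact
  have s: "s \<in> carrier G" using insert by auto
  have finH: "finite H" using finite_carrier H.subset finite_subset by blast
  let ?K = "{h \<otimes> s [^] (j::int) | h j. h \<in> H}"
  have sK: "subgroup ?K G" by (rule subgroup_adjoin[OF sH s])
  have "insert s S \<union> P \<subseteq> ?K"
  proof
    fix y assume "y \<in> insert s S \<union> P"
    then consider "y = s" | "y \<in> H" unfolding H_def using generate.incl[of y "S \<union> P" G] by blast
    then show "y \<in> ?K"
    proof cases
      case 1
      then have "y = \<one> \<otimes> s [^] (1::int)" using s by simp
      then show ?thesis using H.one_closed by blast
    next
      case 2
      then have "y = y \<otimes> s [^] (0::int)" by simp
      then show ?thesis using 2 by blast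
    qed
  qed
  then have "generate G (insert s S \<union> P) \<subseteq> ?K" using generate_subgroup_incl sK by blast
  \<comment> \<open>The part of the exponent of \<open>s\<close> divisible by p yields an element of
    \<open>P\<close> and is absorbed into \<open>H\<close>; only the remainder modulo p
    stays.\<close>
  also have "?K \<subseteq> (\<lambda>(h, j). h \<otimes> s [^] j) ` (H \<times> {0..<int p})"
  proof
    fix y assume "y \<in> ?K"
    then obtain h and j :: int where h: "h \<in> H" "y = h \<otimes> s [^] j" by blast
    have "s [^] (int p * (j div int p)) = (s [^] (j div int p)) [^] p"
      using s by (metis int_pow_int int_pow_pow mult.commute)
    then have sp: "s [^] (int p * (j div int p)) \<in> H"
      using assms(2)[of "s [^] (j div int p)"] s generate.incl[of _ "S \<union> P" G] unfolding H_def by auto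
    have "s [^] j = s [^] (int p * (j div int p)) \<otimes> s [^] (j mod int p)"
      using s int_pow_mult[of s "int p * (j div int p)" "j mod int p"] by simp
    then have "y = (h \<otimes> s [^] (int p * (j div int p))) \<otimes> s [^] (j mod int p)"
      using h s by (simp add: m_assoc)
    moreover have "h \<otimes> s [^] (int p * (j div int p)) \<in> H" using h sp by auto
    moreover have "j mod int p \<in> {0..<int p}" using p0 by simp
    ultimately show "y \<in> (\<lambda>(h, j). h \<otimes> s [^] j) ` (H \<times> {0..<int p})"
      by (intro image_eqI[where x = "(h \<otimes> s [^] (int p * (j div int p)), j mod int p)"]) auto
  qed
  finally have "card (generate G (insert s S \<union> P)) \<le> card (H \<times> {0..<int p})"
    using finH by (meson card_image_le card_mono finite_SigmaI finite_atLeastLessThan_int finite_imageI order_trans)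
  also have "\<dots> = p * card H" by (simp add: card_cartesian_product)
  also have "\<dots> \<le> p * (p ^ card S * card P)" using insert unfolding H_def by auto
  finally show ?case using insert by (simp add: mult.assoc)
qed

text \<open>Let \<open>P\<close> be the image of x \<mapsto> x^p. The kernel of this map is the
  socle, so the order of G is the order of \<open>P\<close> times that of the socle. Comparison with
  the bound of \<open>card_generate_le\<close> shows that the socle has order at most p^(card
  S).\<close>

lemma card_generating_set_ge:
  assumes type: "cyclic_type p G ns" and S: "finite S" "S \<subseteq> carrier G" "generate G S = carrier G"
  shows "length ns \<le> card S"
proof -
  have p1: "p > 1" using prime_p prime_gt_1_nat by blast
  let ?f = "\<lambda>x. x [^] p"
  have hom: "group_hom G G ?f"
    using is_group nat_pow_distrib
    by (auto simp: group_hom_def group_hom_axioms_def hom_def)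
  interpret f: group_hom G G ?f by fact
  define P where "P = ?f ` carrier G"
  have sP: "subgroup P G" unfolding P_def by (rule f.img_is_subgroup)
  have K: "kernel G G ?f = power_socle G p 0" unfolding power_socle_def kernel_def by force
  have "card (rcosets (kernel G G ?f)) * card (kernel G G ?f) = order G"
    using lagrange[OF f.subgroup_kernel] .
  \<comment> \<open>First isomorphism theorem: cosets of the kernel correspond to p-th
    powers.\<close>
  moreover have "card (rcosets (kernel G G ?f)) = card P"
  proof -
    have "inj_on (\<lambda>C. the_elem (?f ` C)) (carrier (G Mod kernel G G ?f))" by (rule f.FactGroup_inj_on)
    moreover have "(\<lambda>C. the_elem (?f ` C)) ` carrier (G Mod kernel G G ?f) = P"
      unfolding carrier_FactGroup image_image P_def
    proof (rule image_cong[OF refl])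
      fix x assume x: "x \<in> carrier G"
      have "?f (k \<otimes> x) = ?f x" if "k \<in> kernel G G ?f" for k
        using that x unfolding kernel_def by (simp add: nat_pow_distrib)
      moreover have "\<one> \<in> kernel G G ?f" by (simp add: kernel_def)
      moreover have "?f ` (kernel G G ?f #> x) = (\<lambda>k. ?f (k \<otimes> x)) ` kernel G G ?f"
        unfolding r_coset_def by (auto simp only: image_iff UN_iff singleton_iff)
      ultimately have "?f ` (kernel G G ?f #> x) = {?f x}" by auto
      then show "the_elem (?f ` (kernel G G ?f #> x)) = ?f x" by simp
    qed
    ultimately have "card (carrier (G Mod kernel G G ?f)) = card P" using card_image by metis
    then show ?thesis by (simp add: FactGroup_def)
  qed
  ultimately have 1: "card P * card (power_socle G p 0) = card (carrier G)" using K by (simp add: order_def)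
  have "carrier G \<subseteq> generate G (S \<union> P)" using S mono_generate[of S "S \<union> P"] by blast
  moreover have "generate G (S \<union> P) \<subseteq> carrier G"
    using S subgroup.subset[OF sP] by (intro generate_incl) auto
  ultimately have "card (carrier G) \<le> p ^ card S * card P"
    using card_generate_le[OF sP _ S(1,2)] unfolding P_def by auto
  moreover have "card P > 0" using sP finite_carrier subgroup.finite_imp_card_positive by blast
  ultimately have "card (power_socle G p 0) \<le> p ^ card S" using 1 by (simp add: mult.commute[of "card P"] flip: 1)
  then have "\<not> card S < length ns" unfolding cyclic_type_length_iff[OF is_group prime_p type] by simp
  then show ?thesis by simp
qed

lemma group_rank_eq_length:
  assumes "cyclic_type p G ns"
  shows "group_rank G = length ns"
proof -
  obtain ms S where ms: "cyclic_type p G ms" and S: "S \<subseteq> carrier G" "finite S" "card S \<le> length ms" "generate G S = carrier G"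
    using cyclic_type_exists[OF finite_abelian_p_group_axioms] by metis
  have "ms = ns" using cyclic_type_unique[OF is_group prime_p ms assms] .
  then have "card S = length ns" using card_generating_set_ge[OF assms S(2,1,4)] S by simp
  then show ?thesis unfolding group_rank_def
    using S card_generating_set_ge[OF assms] by (intro Least_equality) auto
qed

end

section \<open>Rank and \<open>subgroup_var\<close> for a subgroup containing all elements of order
  p\<close>

lemma cyclic_type_card:
  assumes "p > 0" "cyclic_type p G ns"
  shows "card (carrier G) = (\<Prod>i<length ns. p ^ (ns ! i))"
proof -
  have "G \<cong> cyclic_product p ns" using assms(2) unfolding cyclic_type_def by (elim conjE)
  then have "card (carrier G) = card (carrier (cyclic_product p ns))" by (rule iso_same_card)
  also have "\<dots> = (\<Prod>i<length ns. p ^ (ns ! i))"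
    unfolding carrier_product_group using assms(1)
    by (subst card_PiE) (auto simp: carrier_integer_mod_group nat_power_eq)
  finally show ?thesis .
qed

text \<open>Justifies the definite description: the two lists are unique, and so is the last
  position at which they differ.\<close>

lemma subgroup_var_eq:
  assumes A: "group (G\<lparr>carrier := A\<rparr>)" "cyclic_type p (G\<lparr>carrier := A\<rparr>) ns"
    and B: "group (G\<lparr>carrier := B\<rparr>)" "cyclic_type p (G\<lparr>carrier := B\<rparr>) ms"
    and p: "Factorial_Ring.prime p" and "A \<noteq> B"
    and len: "length ns = length ms" and r: "r < length ns" "ns ! r < ms ! r"
    and after: "\<And>j. r < j \<Longrightarrow> j < length ns \<Longrightarrow> ns ! j = ms ! j"
  shows "subgroup_var p G A B = p ^ (ns ! r)"
proof -
  have "(THE v. \<exists>ns ms r. cyclic_type p (G\<lparr>carrier := A\<rparr>) ns \<and> cyclic_type p (G\<lparr>carrier := B\<rparr>) ms \<and>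
        length ns = length ms \<and> r < length ns \<and> ns ! r < ms ! r \<and>
        (\<forall>j. r < j \<and> j < length ns \<longrightarrow> ns ! j = ms ! j) \<and> v = p ^ (ns ! r)) = p ^ (ns ! r)"
  proof (rule the_equality)
    show "\<exists>ns' ms r'. cyclic_type p (G\<lparr>carrier := A\<rparr>) ns' \<and> cyclic_type p (G\<lparr>carrier := B\<rparr>) ms \<and>
        length ns' = length ms \<and> r' < length ns' \<and> ns' ! r' < ms ! r' \<and>
        (\<forall>j. r' < j \<and> j < length ns' \<longrightarrow> ns' ! j = ms ! j) \<and> p ^ (ns ! r) = p ^ (ns' ! r')"
      using A(2) B(2) len r after by (intro exI[of _ ns] exI[of _ ms] exI[of _ r] conjI allI impI) auto
  next
    fix v
    assume "\<exists>ns ms r. cyclic_type p (G\<lparr>carrier := A\<rparr>) ns \<and> cyclic_type p (G\<lparr>carrier := B\<rparr>) ms \<and>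
        length ns = length ms \<and> r < length ns \<and> ns ! r < ms ! r \<and>
        (\<forall>j. r < j \<and> j < length ns \<longrightarrow> ns ! j = ms ! j) \<and> v = p ^ (ns ! r)"
    then obtain ns' ms' r' where *: "cyclic_type p (G\<lparr>carrier := A\<rparr>) ns'" "cyclic_type p (G\<lparr>carrier := B\<rparr>) ms'"
        "length ns' = length ms'" "r' < length ns'" "ns' ! r' < ms' ! r'"
        "\<forall>j. r' < j \<and> j < length ns' \<longrightarrow> ns' ! j = ms' ! j" "v = p ^ (ns' ! r')"
      by (elim exE conjE)
    have eq: "ns' = ns" "ms' = ms"
      using cyclic_type_unique[OF A(1) p *(1) A(2)] cyclic_type_unique[OF B(1) p *(2) B(2)] by blast+
    have "r' = r" using *(4-6) r after unfolding eq by (metis linorder_neqE_nat less_irrefl)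
    then show "v = p ^ (ns ! r)" using *(7) eq by simp
  qed
  then show ?thesis unfolding subgroup_var_def using \<open>A \<noteq> B\<close> by simp
qed

lemma power_socle_mono_carrier:
  assumes "A \<subseteq> B"
  shows "power_socle (G\<lparr>carrier := A\<rparr>) p k \<subseteq> power_socle (G\<lparr>carrier := B\<rparr>) p k"
proof
  fix y assume "y \<in> power_socle (G\<lparr>carrier := A\<rparr>) p k"
  then obtain x where x: "x \<in> carrier (G\<lparr>carrier := A\<rparr>)"
    "x [^]\<^bsub>G\<lparr>carrier := A\<rparr>\<^esub> (p ^ Suc k) = \<one>\<^bsub>G\<lparr>carrier := A\<rparr>\<^esub>" "y = x [^]\<^bsub>G\<lparr>carrier := A\<rparr>\<^esub> (p ^ k)"
    by (rule power_socleE)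
  have "x \<in> carrier (G\<lparr>carrier := B\<rparr>)" using x(1) assms by auto
  then show "y \<in> power_socle (G\<lparr>carrier := B\<rparr>) p k"
    by (rule power_socleI) (use x(2,3) in \<open>simp_all add: nat_pow_def\<close>)
qed

text \<open>Mostly used contrapositively: if the socles differ, then \<open>B\<close> has an element
  outside \<open>A\<close> whose order divides p^(k+1).\<close>

lemma (in group) power_socle_eq_of_exponent:
  assumes "A \<subseteq> B" and k: "\<And>x. x \<in> B \<Longrightarrow> x [^] (p ^ Suc k) = \<one> \<Longrightarrow> x \<in> A"
  shows "power_socle (G\<lparr>carrier := A\<rparr>) p k = power_socle (G\<lparr>carrier := B\<rparr>) p k"
proof
  show "power_socle (G\<lparr>carrier := A\<rparr>) p k \<subseteq> power_socle (G\<lparr>carrier := B\<rparr>) p k"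
    by (rule power_socle_mono_carrier[OF assms(1)])
  show "power_socle (G\<lparr>carrier := B\<rparr>) p k \<subseteq> power_socle (G\<lparr>carrier := A\<rparr>) p k"
  proof
    fix y assume "y \<in> power_socle (G\<lparr>carrier := B\<rparr>) p k"
    then obtain x where x: "x \<in> carrier (G\<lparr>carrier := B\<rparr>)"
      "x [^]\<^bsub>G\<lparr>carrier := B\<rparr>\<^esub> (p ^ Suc k) = \<one>\<^bsub>G\<lparr>carrier := B\<rparr>\<^esub>" "y = x [^]\<^bsub>G\<lparr>carrier := B\<rparr>\<^esub> (p ^ k)"
      by (rule power_socleE)
    have "x [^] (p ^ Suc k) = \<one>" using x(2) by (simp add: nat_pow_def)
    then have "x \<in> carrier (G\<lparr>carrier := A\<rparr>)" using x(1) k by auto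
    then show "y \<in> power_socle (G\<lparr>carrier := A\<rparr>) p k"
      by (rule power_socleI) (use x(2,3) in \<open>simp_all add: nat_pow_def\<close>)
  qed
qed

text \<open>Equal socles for k = 0 give lists \<open>ns\<close> and \<open>ms\<close> of equal
  length, and A \<subseteq> B gives ns ! i \<le> ms ! i for all i. If \<open>r\<close> is the last
  position of strict inequality and k = ns ! r, then \<open>var\<close> is p^k, and the socles for
  this \<open>k\<close> differ in order because position \<open>r\<close> counts for
  \<open>B\<close> and not for \<open>A\<close>.\<close>

lemma (in group) group_rank_and_var_if_omega_subset:
  assumes A: "finite_abelian_p_group (G\<lparr>carrier := A\<rparr>) p" and B: "finite_abelian_p_group (G\<lparr>carrier := B\<rparr>) p"
    and AB: "A \<subseteq> B" and omega: "\<And>x. x \<in> B \<Longrightarrow> x [^] p = \<one> \<Longrightarrow> x \<in> A"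
  shows "group_rank (G\<lparr>carrier := A\<rparr>) = group_rank (G\<lparr>carrier := B\<rparr>)"
    and "A \<noteq> B \<Longrightarrow> \<exists>k. subgroup_var p G A B = p ^ k \<and> (\<exists>x\<in>B - A. x [^] (p ^ Suc k) = \<one>)"
proof -
  interpret A: finite_abelian_p_group "G\<lparr>carrier := A\<rparr>" p by fact
  interpret B: finite_abelian_p_group "G\<lparr>carrier := B\<rparr>" p by fact
  have p0: "p > 0" using A.prime_p prime_gt_0_nat by blast
  obtain ns where ns: "cyclic_type p (G\<lparr>carrier := A\<rparr>) ns" using cyclic_type_exists[OF A] by metis
  obtain ms where ms: "cyclic_type p (G\<lparr>carrier := B\<rparr>) ms" using cyclic_type_exists[OF B] by metis
  note nsI = cyclic_type_nth_iff[OF A.is_group A.prime_p ns] and msI = cyclic_type_nth_iff[OF B.is_group A.prime_p ms]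
  have "power_socle (G\<lparr>carrier := A\<rparr>) p 0 = power_socle (G\<lparr>carrier := B\<rparr>) p 0"
    using omega by (intro power_socle_eq_of_exponent[OF AB]) simp
  then have "i < length ns \<longleftrightarrow> i < length ms" for i
    using cyclic_type_length_iff[OF A.is_group A.prime_p ns] cyclic_type_length_iff[OF B.is_group A.prime_p ms] by simp
  then have len: "length ns = length ms" by (metis linorder_less_linear less_irrefl)
  then show "group_rank (G\<lparr>carrier := A\<rparr>) = group_rank (G\<lparr>carrier := B\<rparr>)"
    using A.group_rank_eq_length[OF ns] B.group_rank_eq_length[OF ms] by simp
  assume neq: "A \<noteq> B"
  have finB: "finite B" using B.finite_carrier by simp
  have "card (power_socle (G\<lparr>carrier := A\<rparr>) p k) \<le> card (power_socle (G\<lparr>carrier := B\<rparr>) p k)" for k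
    using power_socle_mono_carrier[OF AB] power_socle_subset[OF B.is_group] B.finite_carrier
    by (metis card_mono finite_subset)
  then have "k < ns ! i \<Longrightarrow> k < ms ! i" if "i < length ns" for i k
    using nsI[of i k] msI[of i k] that by (metis less_le_trans)
  then have le: "ns ! i \<le> ms ! i" if "i < length ns" for i using that by (metis leI less_irrefl)
  have "ns \<noteq> ms"
  proof
    assume "ns = ms"
    \<comment> \<open>The list determines the order, and a proper subgroup of a finite group has
      smaller order.\<close>
    then have "card A = card B"
      using cyclic_type_card[OF p0 ns] cyclic_type_card[OF p0 ms] by simp
    then show False using AB neq finB card_subset_eq by metis
  qed
  define D where "D = {i. i < length ns \<and> ns ! i \<noteq> ms ! i}"
  have D: "finite D" "D \<noteq> {}" using \<open>ns \<noteq> ms\<close> len by (auto simp: D_def list_eq_iff_nth_eq)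
  define r where "r = Max D"
  have "r \<in> D" using D Max_in by (simp add: r_def)
  then have r: "r < length ns" "ns ! r < ms ! r" using le[of r] by (auto simp: D_def)
  have after: "ns ! j = ms ! j" if "r < j" "j < length ns" for j
  proof (rule ccontr)
    assume "ns ! j \<noteq> ms ! j"
    then have "j \<le> r" using D that by (simp add: r_def D_def)
    then show False using that by simp
  qed
  have "subgroup_var p G A B = p ^ (ns ! r)"
    by (rule subgroup_var_eq[OF A.is_group ns B.is_group ms A.prime_p neq len r after])
  moreover have "\<exists>x\<in>B - A. x [^] (p ^ Suc (ns ! r)) = \<one>"
  proof (rule ccontr)
    assume "\<not> ?thesis"
    then have "power_socle (G\<lparr>carrier := A\<rparr>) p (ns ! r) = power_socle (G\<lparr>carrier := B\<rparr>) p (ns ! r)"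
      by (intro power_socle_eq_of_exponent[OF AB]) blast
    then show False using nsI[of r "ns ! r"] msI[of r "ns ! r"] r len by simp
  qed
  ultimately show "\<exists>k. subgroup_var p G A B = p ^ k \<and> (\<exists>x\<in>B - A. x [^] (p ^ Suc k) = \<one>)" by blast
qed

section \<open>Center and abelian quotients of p-groups\<close>

text \<open>Orbit lengths are powers of p, and those of orbits with more than one point are
  divisible by p. The indicator function \<open>?f\<close> is summed orbit by orbit.\<close>

lemma (in group_action) dvd_card_non_fixed_points:
  assumes p: "Factorial_Ring.prime (p::nat)" and order: "order G = p ^ k" and E: "finite E"
  shows "p dvd card {x \<in> E. orbit G \<phi> x \<noteq> {x}}"
proof -
  let ?f = "\<lambda>x. if orbit G \<phi> x \<noteq> {x} then 1 else (0::nat)"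
  have "p dvd (\<Sum>x\<in>Q. ?f x)" if Q: "Q \<in> orbits G E \<phi>" for Q
  proof -
    obtain x where x: "x \<in> E" "Q = orbit G \<phi> x" using Q unfolding orbits_def by blast
    have orb: "orbit G \<phi> y = Q" if "y \<in> Q" for y
    proof -
      have y: "y \<in> E" using that Q orbits_coverture by blast
      then have "orbit G \<phi> y \<in> orbits G E \<phi>" unfolding orbits_def by blast
      moreover have "y \<in> orbit G \<phi> y" using orbit_refl y by blast
      ultimately show ?thesis using disjoint_union Q that by blast
    qed
    have "card Q dvd p ^ k" using orbit_stabilizer_theorem[OF x(1)] x(2) order by (metis dvd_triv_left)
    then obtain j where j: "card Q = p ^ j" using p divides_primepow_nat by metis
    show ?thesis
    proof (cases "j = 0")
      case True
      then have "card Q = 1" using j by simp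
      then obtain z where "Q = {z}" using card_1_singletonE by blast
      then have "(\<Sum>x\<in>Q. ?f x) = 0" using orb by simp
      then show ?thesis by simp
    next
      case False
      then have "p dvd card Q" using j by simp
      moreover have "?f y = 1" if "y \<in> Q" for y
      proof -
        have "Q \<noteq> {y}"
        proof
          assume "Q = {y}"
          then have "p ^ j = 1" using j by simp
          then show False using False p by (simp add: prime_nat_iff)
        qed
        then show ?thesis using orb[OF that] by simp
      qed
      ultimately show ?thesis by simp
    qed
  qed
  then have "p dvd (\<Sum>Q\<in>orbits G E \<phi>. \<Sum>x\<in>Q. ?f x)" by (rule dvd_sum)
  also have "\<dots> = (\<Sum>x\<in>E. ?f x)" by (rule disjoint_sum[OF E])
  also have "\<dots> = card {x \<in> E. orbit G \<phi> x \<noteq> {x}}"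
    by (rule card_as_sums[OF refl E, symmetric])
  finally show ?thesis .
qed

section \<open>The center, and proper normal subgroups with abelian quotient\<close>

lemma center_commute:
  "z \<in> center G \<Longrightarrow> g \<in> carrier G \<Longrightarrow> z \<otimes>\<^bsub>G\<^esub> g = g \<otimes>\<^bsub>G\<^esub> z"
  unfolding center_def by blast

lemma center_subset: "center G \<subseteq> carrier G"
  unfolding center_def by blast

lemma (in group) subgroup_center: "subgroup (center G) G"
proof (rule subgroupI)
  show "center G \<subseteq> carrier G" by (rule center_subset)
  have "\<one> \<in> center G" by (simp add: center_def)
  then show "center G \<noteq> {}" by blast
next
  fix a assume a: "a \<in> center G"
  have ac: "a \<in> carrier G" using center_subset[of G] a by blast
  have "inv a \<otimes> g = g \<otimes> inv a" if g: "g \<in> carrier G" for g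
  proof -
    have "inv (a \<otimes> inv g) = inv (inv g \<otimes> a)" using center_commute[OF a, of "inv g"] g by simp
    then show ?thesis using ac g by (simp add: inv_mult_group)
  qed
  then show "inv a \<in> center G" using ac by (simp add: center_def)
next
  fix a b assume ab: "a \<in> center G" "b \<in> center G"
  have c: "a \<in> carrier G" "b \<in> carrier G" using center_subset[of G] ab by blast+
  have "a \<otimes> b \<otimes> g = g \<otimes> (a \<otimes> b)" if g: "g \<in> carrier G" for g
  proof -
    have "a \<otimes> b \<otimes> g = a \<otimes> (g \<otimes> b)" using center_commute[OF ab(2) g] c g by (simp add: m_assoc)
    also have "\<dots> = (a \<otimes> g) \<otimes> b" using c g by (simp add: m_assoc)
    also have "\<dots> = g \<otimes> (a \<otimes> b)" using center_commute[OF ab(1) g] c g by (simp add: m_assoc)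
    finally show ?thesis .
  qed
  then show "a \<otimes> b \<in> center G" using c by (simp add: center_def)
qed

context finite_p_group
begin

text \<open>Class equation: the fixed points of conjugation are the central elements, so p divides
  the number of non-central elements as well as the group order, and hence the order of the
  center.\<close>

lemma center_nontrivial:
  assumes "carrier G \<noteq> {\<one>}"
  shows "center G \<noteq> {\<one>}"
proof -
  let ?\<phi> = "\<lambda>g. \<lambda>h \<in> carrier G. g \<otimes> h \<otimes> inv g"
  interpret conj: group_action G "carrier G" ?\<phi> by (rule action_by_conjugation)
  obtain k where k: "order G = p ^ k" using prime_power_order by blast
  have fixed: "orbit G ?\<phi> x = {x} \<longleftrightarrow> x \<in> center G" if x: "x \<in> carrier G" for x
  proof -
    have "g \<otimes> x \<otimes> inv g = x \<longleftrightarrow> x \<otimes> g = g \<otimes> x" if g: "g \<in> carrier G" for g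
      using g x by (metis inv_solve_right m_closed)
    moreover have "orbit G ?\<phi> x = {x} \<longleftrightarrow> (\<forall>g\<in>carrier G. g \<otimes> x \<otimes> inv g = x)"
      unfolding orbit_def using x by (auto intro: exI[of _ \<one>])
    ultimately show ?thesis unfolding center_def using x by auto
  qed
  have sub: "center G \<subseteq> carrier G" unfolding center_def by blast
  have "carrier G - center G = {x \<in> carrier G. orbit G ?\<phi> x \<noteq> {x}}" using fixed by blast
  then have "p dvd card (carrier G - center G)"
    using conj.dvd_card_non_fixed_points[OF prime_p k finite_carrier] by simp
  moreover have "card (carrier G - center G) = card (carrier G) - card (center G)"
    using card_Diff_subset sub finite_carrier finite_subset by metis
  moreover have "card (center G) \<le> card (carrier G)" using sub finite_carrier card_mono by metis
  moreover have "p dvd card (carrier G)"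
  proof -
    have "k \<noteq> 0"
    proof
      assume "k = 0"
      then have "order G = 1" using k by simp
      then show False using assms order_one_triv_iff by blast
    qed
    then show ?thesis using k by (simp add: order_def)
  qed
  ultimately have "p dvd card (center G)"
    by (metis dvd_diffD1)
  then show ?thesis using prime_p by (auto simp: prime_nat_iff)
qed

text \<open>Take \<open>M\<close> maximal among the proper normal subgroups containing
  \<open>N\<close>. The preimage \<open>C\<close> of the center of G/M is normal and strictly larger
  than \<open>M\<close>, because the nontrivial p-group G/M has nontrivial center. So
  \<open>C\<close> is everything and G/M is abelian.\<close>

lemma exists_proper_normal_abelian_quotient:
  assumes "N \<lhd> G" "N \<noteq> carrier G"
  obtains M where "M \<lhd> G" "N \<subseteq> M" "M \<noteq> carrier G" "comm_group (G Mod M)"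
proof -
  define F where "F = {M. M \<lhd> G \<and> N \<subseteq> M \<and> M \<noteq> carrier G}"
  have "F \<subseteq> Pow (carrier G)" unfolding F_def using normal_imp_subgroup subgroup.subset by blast
  then have fin: "finite F" by (rule finite_subset) (simp add: finite_carrier)
  have "N \<in> F" using assms by (simp add: F_def)
  then obtain M where M: "M \<in> F" and max: "\<And>K. K \<in> F \<Longrightarrow> M \<subseteq> K \<Longrightarrow> K = M"
    using finite_has_maximal[OF fin] by blast
  have nM: "M \<lhd> G" and NM: "N \<subseteq> M" and MG: "M \<noteq> carrier G" using M by (auto simp: F_def)
  interpret M: normal M G by fact
  interpret Q: finite_p_group "G Mod M" p by (rule FactGroup_finite_p_group[OF nM])
  define \<pi> where "\<pi> g = M #> g" for g
  have \<pi>: "\<pi> \<in> hom G (G Mod M)" unfolding \<pi>_def using M.r_coset_hom_Mod by simp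
  interpret \<pi>: group_hom G "G Mod M" \<pi>
    using \<pi> is_group Q.is_group by (simp add: group_hom_def group_hom_axioms_def)
  have \<pi>surj: "\<pi> ` carrier G = carrier (G Mod M)" by (simp add: \<pi>_def carrier_FactGroup)
  have \<pi>1: "\<pi> g = \<one>\<^bsub>G Mod M\<^esub> \<longleftrightarrow> g \<in> M" if "g \<in> carrier G" for g
    using that M.subgroup_axioms unfolding \<pi>_def one_FactGroup
    by (metis coset_join1 coset_join2 M.subset)
  define C where "C = {g \<in> carrier G. \<pi> g \<in> center (G Mod M)}"
  have conj: "g \<otimes> c \<otimes> inv g \<in> C" if c: "c \<in> C" and g: "g \<in> carrier G" for c g
  proof -
    have cc: "c \<in> carrier G" "\<pi> c \<in> center (G Mod M)" using c by (auto simp: C_def)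
    have "\<pi> (g \<otimes> c \<otimes> inv g) = \<pi> g \<otimes>\<^bsub>G Mod M\<^esub> \<pi> c \<otimes>\<^bsub>G Mod M\<^esub> inv\<^bsub>G Mod M\<^esub> \<pi> g"
      using cc g by (simp only: \<pi>.hom_mult \<pi>.hom_inv m_closed inv_closed)
    also have "\<dots> = \<pi> c \<otimes>\<^bsub>G Mod M\<^esub> (\<pi> g \<otimes>\<^bsub>G Mod M\<^esub> inv\<^bsub>G Mod M\<^esub> \<pi> g)"
      using center_commute[OF cc(2) \<pi>.hom_closed[OF g]] Q.m_assoc \<pi>.hom_closed g cc Q.inv_closed by metis
    also have "\<dots> = \<pi> c" using g cc(1) by (simp only: \<pi>.hom_closed Q.r_inv Q.r_one)
    finally show ?thesis using cc g by (simp add: C_def)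
  qed
  interpret Z: subgroup "center (G Mod M)" "G Mod M" by (rule Q.subgroup_center)
  have "subgroup C G"
  proof (rule subgroupI)
    show "C \<subseteq> carrier G" by (auto simp: C_def)
    have "\<one> \<in> C" unfolding C_def using \<pi>.hom_one Z.one_closed by simp
    then show "C \<noteq> {}" by blast
    show "inv a \<in> C" if "a \<in> C" for a
      using that Z.m_inv_closed[of "\<pi> a"] by (simp add: C_def)
    show "a \<otimes> b \<in> C" if "a \<in> C" "b \<in> C" for a b
      using that Z.m_closed[of "\<pi> a" "\<pi> b"] by (simp add: C_def del: mult_FactGroup)
  qed
  then have nC: "C \<lhd> G" using conj by (intro normal_invI) auto
  have "M \<subseteq> C"
  proof
    fix g assume g: "g \<in> M"
    then have "\<pi> g = \<one>\<^bsub>G Mod M\<^esub>" using \<pi>1[of g] M.mem_carrier by blast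
    then show "g \<in> C" unfolding C_def using Z.one_closed M.mem_carrier[OF g] by simp
  qed
  moreover have "C \<noteq> M"
  proof -
    have "carrier (G Mod M) \<noteq> {\<one>\<^bsub>G Mod M\<^esub>}"
    proof
      assume *: "carrier (G Mod M) = {\<one>\<^bsub>G Mod M\<^esub>}"
      have "carrier G \<subseteq> M" using \<pi>1 \<pi>surj unfolding * by blast
      then show False using MG M.subset by blast
    qed
    then have "center (G Mod M) \<noteq> {\<one>\<^bsub>G Mod M\<^esub>}" by (rule Q.center_nontrivial)
    moreover have "\<one>\<^bsub>G Mod M\<^esub> \<in> center (G Mod M)" by (rule Z.one_closed)
    ultimately obtain z where z: "z \<in> center (G Mod M)" "z \<noteq> \<one>\<^bsub>G Mod M\<^esub>" by blast
    then have "z \<in> \<pi> ` carrier G" unfolding \<pi>surj center_def by blast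
    then obtain g where g: "g \<in> carrier G" "\<pi> g = z" by blast
    then show ?thesis using z \<pi>1[OF g(1)] unfolding C_def by blast
  qed
  ultimately have "C \<notin> F" using max by blast
  then have CG: "C = carrier G" using nC NM \<open>M \<subseteq> C\<close> by (auto simp: F_def)
  have "comm_group (G Mod M)"
  proof (rule Q.group_comm_groupI)
    fix u v assume u: "u \<in> carrier (G Mod M)" and v: "v \<in> carrier (G Mod M)"
    have "u \<in> center (G Mod M)" using u CG unfolding \<pi>surj[symmetric] C_def by blast
    then show "u \<otimes>\<^bsub>G Mod M\<^esub> v = v \<otimes>\<^bsub>G Mod M\<^esub> u" using v by (rule center_commute)
  qed
  then show thesis using that nM NM MG by blast
qed

end

section \<open>Central automorphisms and the lower central series\<close>

context group
begin

text \<open>A conjugate of a commutator is the commutator of the conjugates, so the generating set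
  is invariant under conjugation.\<close>

lemma lower_central_normal: "lower_central G n \<lhd> G"
\<comment> \<open>The induction rule also varies the structure. The predicate ignores that argument,
  so that \<open>G\<close> stays fixed.\<close>
proof (induction n rule: lower_central.induct[of "\<lambda>_ n. lower_central G n \<lhd> G" undefined, rotated 2])
  fix H :: "('a, 'b) monoid_scheme" and n
  assume IH: "lower_central G (Suc n) \<lhd> G"
  interpret N: normal "lower_central G (Suc n)" G by fact
  let ?S = "\<Union>h\<in>lower_central G (Suc n). \<Union>k\<in>carrier G. {h \<otimes> k \<otimes> inv h \<otimes> inv k}"
  have "generate G ?S \<lhd> G"
  proof (rule normal_generateI)
    show "?S \<subseteq> carrier G" by auto
    fix c g assume "c \<in> ?S" and g: "g \<in> carrier G"
    then obtain h k where hk: "h \<in> lower_central G (Suc n)" "k \<in> carrier G" "c = h \<otimes> k \<otimes> inv h \<otimes> inv k" by blast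
    let ?h = "g \<otimes> h \<otimes> inv g" and ?k = "g \<otimes> k \<otimes> inv g"
    have hc: "h \<in> carrier G" using hk N.subset by blast
    have cancel: "inv g \<otimes> (g \<otimes> x) = x" if "x \<in> carrier G" for x
      using g that by (simp add: m_assoc[symmetric])
    have "?h \<in> lower_central G (Suc n)" "?k \<in> carrier G" using N.inv_op_closed2 g hk by auto
    moreover have "g \<otimes> c \<otimes> inv g = ?h \<otimes> ?k \<otimes> inv ?h \<otimes> inv ?k"
      using hk(2,3) hc g by (simp add: inv_mult_group m_assoc cancel)
    ultimately show "g \<otimes> c \<otimes> inv g \<in> ?S" by blast
  qed
  then show "lower_central G (Suc (Suc n)) \<lhd> G" by (simp add: commutator_subgroup_def)
qed (simp_all add: normal_self)

lemma commutator_in_lower_central: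
  assumes "h \<in> lower_central G (Suc n)" "k \<in> carrier G"
  shows "h \<otimes> k \<otimes> inv h \<otimes> inv k \<in> lower_central G (Suc (Suc n))"
  unfolding lower_central.simps commutator_subgroup_def
  using assms by (intro generate.incl) blast

lemma lower_central_Suc_Suc_subset:
  assumes "subgroup H G"
    and "\<And>h k. h \<in> lower_central G (Suc n) \<Longrightarrow> k \<in> carrier G \<Longrightarrow> h \<otimes> k \<otimes> inv h \<otimes> inv k \<in> H"
  shows "lower_central G (Suc (Suc n)) \<subseteq> H"
  unfolding lower_central.simps commutator_subgroup_def
  using assms by (intro generate_subgroup_incl) blast+

lemma lower_central_subset_carrier: "lower_central G n \<subseteq> carrier G"
  by (rule subgroup.subset[OF normal_imp_subgroup[OF lower_central_normal]])

lemma lower_central_subset_2: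
  assumes "n \<ge> 2"
  shows "lower_central G n \<subseteq> lower_central G 2"
proof -
  obtain m where n: "n = Suc (Suc m)" using assms by (metis Suc_le_D numeral_2_eq_2 Suc_le_mono)
  show ?thesis unfolding n numeral_2_eq_2
  proof (rule lower_central_Suc_Suc_subset)
    show "subgroup (lower_central G (Suc (Suc 0))) G"
      by (rule normal_imp_subgroup[OF lower_central_normal])
    fix h k assume "h \<in> lower_central G (Suc m)" "k \<in> carrier G"
    moreover from this have "h \<in> lower_central G (Suc 0)"
      using lower_central_subset_carrier by auto
    ultimately show "h \<otimes> k \<otimes> inv h \<otimes> inv k \<in> lower_central G (Suc (Suc 0))"
      by (intro commutator_in_lower_central)
  qed
qed

lemma lower_central_2: "lower_central G 2 = derived G (carrier G)"
  by (simp add: numeral_2_eq_2 commutator_subgroup_def derived_def)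

text \<open>Commutators lie in the kernel. Commutativity is asked of the values of \<open>f\<close>,
  which suits homomorphisms from a non-abelian group into its own center.\<close>

lemma hom_trivial_on_lower_central_2:
  assumes "group B" "f \<in> hom G B"
    and comm: "\<And>a b. a \<in> carrier G \<Longrightarrow> b \<in> carrier G \<Longrightarrow> f a \<otimes>\<^bsub>B\<^esub> f b = f b \<otimes>\<^bsub>B\<^esub> f a"
    and x: "x \<in> lower_central G 2"
  shows "f x = \<one>\<^bsub>B\<^esub>"
proof -
  interpret B: group B by fact
  interpret f: group_hom G B f using assms by (simp add: group_hom_def group_hom_axioms_def is_group)
  have "lower_central G (Suc (Suc 0)) \<subseteq> kernel G B f"
  proof (rule lower_central_Suc_Suc_subset)
    show "subgroup (kernel G B f) G" by (rule f.subgroup_kernel)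
    fix h k assume h: "h \<in> lower_central G (Suc 0)" and k: "k \<in> carrier G"
    then have h: "h \<in> carrier G" by simp
    have "f (h \<otimes> k \<otimes> inv h \<otimes> inv k) = f h \<otimes>\<^bsub>B\<^esub> f k \<otimes>\<^bsub>B\<^esub> inv\<^bsub>B\<^esub> f h \<otimes>\<^bsub>B\<^esub> inv\<^bsub>B\<^esub> f k"
      using h k by simp
    also have "\<dots> = \<one>\<^bsub>B\<^esub>" unfolding comm[OF h k] using h k by (simp add: B.m_assoc)
    finally show "h \<otimes> k \<otimes> inv h \<otimes> inv k \<in> kernel G B f" using h k by (simp add: kernel_def)
  qed
  then show ?thesis using x by (auto simp: numeral_2_eq_2 kernel_def)
qed

section \<open>Automorphisms trivial modulo a normal subgroup, and central automorphisms\<close>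

lemma auts_trivial_modD:
  assumes "M \<lhd> G" "\<alpha> \<in> auts_trivial_mod G M" "g \<in> carrier G"
  shows "inv g \<otimes> \<alpha> g \<in> M"
proof -
  interpret M: normal M G by fact
  have "M #> g \<in> carrier (G Mod M)" using assms(3) by (auto simp: carrier_FactGroup)
  then have "\<alpha> ` (M #> g) = M #> g" using assms(2) unfolding auts_trivial_mod_def by blast
  moreover have "g \<in> M #> g" using assms(3) by (rule rcos_self[OF _ M.subgroup_axioms])
  ultimately have "\<alpha> g \<in> M #> g" by blast
  then obtain m where m: "m \<in> M" "\<alpha> g = m \<otimes> g" unfolding r_coset_def by blast
  then have "inv g \<otimes> \<alpha> g = inv g \<otimes> m \<otimes> g" using assms(3) M.mem_carrier by (simp add: m_assoc)
  then show ?thesis using M.inv_op_closed1 assms(3) m by simp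
qed

text \<open>The elementwise condition maps each coset into itself; finiteness and injectivity make
  the image the whole coset. The coset of the identity accounts for \<open>M\<close> itself.\<close>

lemma auts_trivial_modI:
  assumes "M \<lhd> G" and fin: "finite (carrier G)" and \<alpha>: "\<alpha> \<in> auto G"
    and M: "\<And>g. g \<in> carrier G \<Longrightarrow> inv g \<otimes> \<alpha> g \<in> M"
  shows "\<alpha> \<in> auts_trivial_mod G M"
proof -
  interpret M: normal M G by fact
  have inj: "inj_on \<alpha> (carrier G)" and \<alpha>c: "\<And>g. g \<in> carrier G \<Longrightarrow> \<alpha> g \<in> carrier G"
    using \<alpha> by (auto simp: auto_def Bij_def bij_betw_def)
  have coset: "\<alpha> ` (M #> g) = M #> g" if g: "g \<in> carrier G" for g
  proof -
    have sub: "M #> g \<subseteq> carrier G" using g by (simp add: M.subset r_coset_subset_G)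
    have "\<alpha> ` (M #> g) \<subseteq> M #> g"
    proof
      fix y assume "y \<in> \<alpha> ` (M #> g)"
      then obtain x where x: "x \<in> M #> g" "y = \<alpha> x" by blast
      have xc: "x \<in> carrier G" using x sub by blast
      have "M #> x = M #> g" using M.subgroup_axioms g x(1) by (metis repr_independence)
      \<comment> \<open>Conjugation by \<open>x\<close> turns the displacement into
        \<open>\<alpha> x \<otimes> inv x\<close>, the form that fits right cosets.\<close>
      have "x \<otimes> (inv x \<otimes> \<alpha> x) \<otimes> inv x \<in> M" using M.inv_op_closed2[OF xc M[OF xc]] .
      then have "\<alpha> x \<otimes> inv x \<in> M" using xc \<alpha>c by (simp add: inv_solve_left m_assoc[symmetric])
      then have "\<alpha> x \<otimes> inv x \<otimes> x \<in> M #> x" unfolding r_coset_def by blast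
      then have "\<alpha> x \<in> M #> x" using xc \<alpha>c by (simp add: m_assoc)
      then show "y \<in> M #> g" using x \<open>M #> x = M #> g\<close> by simp
    qed
    moreover have "finite (M #> g)" using sub fin finite_subset by blast
    moreover have "inj_on \<alpha> (M #> g)" using inj sub inj_on_subset by blast
    ultimately show ?thesis using endo_inj_surj by blast
  qed
  have "\<alpha> ` M = M" using coset[of \<one>] M.subset by simp
  then show ?thesis using \<alpha> coset unfolding auts_trivial_mod_def by (auto simp: carrier_FactGroup)
qed

lemma conjugation_in_auto:
  assumes "x \<in> carrier G"
  shows "(\<lambda>g\<in>carrier G. x \<otimes> g \<otimes> inv x) \<in> auto G"
proof -
  let ?c = "\<lambda>g\<in>carrier G. x \<otimes> g \<otimes> inv x"
  have "?c \<in> hom G G"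
  proof (rule homI)
    fix g h assume gh: "g \<in> carrier G" "h \<in> carrier G"
    have "x \<otimes> g \<otimes> inv x \<otimes> (x \<otimes> h \<otimes> inv x) = x \<otimes> g \<otimes> (inv x \<otimes> x) \<otimes> h \<otimes> inv x"
      using gh assms by (simp only: m_assoc m_closed inv_closed)
    also have "\<dots> = x \<otimes> (g \<otimes> h) \<otimes> inv x" using gh assms by (simp add: m_assoc)
    finally show "?c (g \<otimes> h) = ?c g \<otimes> ?c h" using gh by simp
  qed (use assms in simp)
  then show ?thesis using conjugation_is_bij[OF assms] by (simp add: auto_def Bij_def)
qed

text \<open>The map is a homomorphism because the values of \<open>f\<close> are central. If x f(x)
  = 1, then \<open>x\<close> is the inverse of a central element and so central itself; this is why
  the last hypothesis speaks of central \<open>x\<close> alone. Injectivity gives surjectivity by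
  finiteness.\<close>

lemma central_hom_in_central_auts:
  assumes fin: "finite (carrier G)" and f: "f \<in> hom G G"
    and Z: "\<And>g. g \<in> carrier G \<Longrightarrow> f g \<in> center G"
    and inv: "\<And>x. x \<in> center G \<Longrightarrow> f x = inv x \<Longrightarrow> x = \<one>"
  shows "(\<lambda>g\<in>carrier G. g \<otimes> f g) \<in> central_auts G"
proof -
  let ?\<alpha> = "\<lambda>g\<in>carrier G. g \<otimes> f g"
  interpret Z: subgroup "center G" G by (rule subgroup_center)
  have fc: "f g \<in> carrier G" if "g \<in> carrier G" for g using Z[OF that] by simp
  have hom: "?\<alpha> \<in> hom G G"
  proof (rule homI)
    fix g h assume gh: "g \<in> carrier G" "h \<in> carrier G"
    have "f (g \<otimes> h) = f g \<otimes> f h" by (rule hom_mult[OF f gh])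
    then have "g \<otimes> h \<otimes> f (g \<otimes> h) = g \<otimes> (h \<otimes> f g) \<otimes> f h" using gh fc by (simp add: m_assoc)
    also have "\<dots> = g \<otimes> (f g \<otimes> h) \<otimes> f h" using center_commute[OF Z[OF gh(1)] gh(2)] by simp
    also have "\<dots> = (g \<otimes> f g) \<otimes> (h \<otimes> f h)" using gh fc by (simp add: m_assoc)
    finally show "?\<alpha> (g \<otimes> h) = ?\<alpha> g \<otimes> ?\<alpha> h" using gh by simp
  qed (use fc in simp)
  interpret \<alpha>: group_hom G G ?\<alpha> using hom is_group by (simp add: group_hom_def group_hom_axioms_def)
  have "inj_on ?\<alpha> (carrier G)"
  proof (subst \<alpha>.inj_on_one_iff, intro allI impI)
    fix x assume x: "x \<in> carrier G" and "?\<alpha> x = \<one>"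
    then have 1: "x \<otimes> f x = \<one>" by simp
    have "x = inv (f x)" using 1 x fc[OF x] inv_equality by metis
    then have "x \<in> center G" using Z[OF x] Z.m_inv_closed by metis
    moreover have "f x = inv x" using \<open>x = inv (f x)\<close> fc[OF x] by (metis inv_inv)
    ultimately show "x = \<one>" by (rule inv)
  qed
  moreover have "?\<alpha> ` carrier G \<subseteq> carrier G" using fc by auto
  ultimately have "bij_betw ?\<alpha> (carrier G) (carrier G)"
    unfolding bij_betw_def using endo_inj_surj[OF fin] by blast
  then have "?\<alpha> \<in> auto G" using hom by (simp add: auto_def Bij_def)
  moreover have "inv g \<otimes> ?\<alpha> g \<in> center G" if g: "g \<in> carrier G" for g
    using g fc[OF g] Z[OF g] by (simp add: m_assoc[symmetric])
  ultimately show ?thesis unfolding central_auts_def by blast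
qed

text \<open>The map sending g to \<open>inv g \<otimes> \<alpha> g\<close> is a homomorphism into
  the center and therefore kills all commutators.\<close>

lemma central_auts_fix_lower_central_2:
  assumes "\<alpha> \<in> central_auts G" "x \<in> lower_central G 2"
  shows "\<alpha> x = x"
proof -
  interpret Z: subgroup "center G" G by (rule subgroup_center)
  have \<alpha>: "\<alpha> \<in> hom G G" and Z: "\<And>g. g \<in> carrier G \<Longrightarrow> inv g \<otimes> \<alpha> g \<in> center G"
    using assms by (auto simp: central_auts_def auto_def)
  have \<alpha>c: "\<alpha> g \<in> carrier G" if "g \<in> carrier G" for g using hom_in_carrier[OF \<alpha> that] .
  let ?f = "\<lambda>g. inv g \<otimes> \<alpha> g"
  have "?f \<in> hom G G"
  proof (rule homI)
    fix g h assume gh: "g \<in> carrier G" "h \<in> carrier G"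
    have "?f (g \<otimes> h) = inv h \<otimes> (?f g \<otimes> \<alpha> h)"
      using gh \<alpha>c hom_mult[OF \<alpha> gh] by (simp add: inv_mult_group m_assoc)
    also have "\<dots> = inv h \<otimes> (\<alpha> h \<otimes> ?f g)" using center_commute[OF Z[OF gh(1)] \<alpha>c[OF gh(2)]] by simp
    also have "\<dots> = ?f h \<otimes> ?f g" using gh \<alpha>c by (simp add: m_assoc)
    also have "\<dots> = ?f g \<otimes> ?f h" using center_commute[OF Z[OF gh(2)], of "?f g"] gh \<alpha>c by simp
    finally show "?f (g \<otimes> h) = ?f g \<otimes> ?f h" .
  qed (use \<alpha>c in simp)
  then have "?f x = \<one>"
    by (rule hom_trivial_on_lower_central_2[OF is_group _ _ assms(2)])
      (use Z \<alpha>c in \<open>auto intro: center_commute\<close>)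
  moreover have "x \<in> carrier G" using assms(2) lower_central_subset_carrier by blast
  ultimately show ?thesis using \<alpha>c by (metis inv_equality inv_inv inv_closed)
qed

end

section \<open>Homomorphisms into the center through an abelian quotient\<close>

lemma (in finite_p_group) finite_abelian_p_group_center_subgroup:
  assumes "subgroup H G" "H \<subseteq> center G"
  shows "finite_abelian_p_group (G\<lparr>carrier := H\<rparr>) p"
proof -
  have "comm_group (G\<lparr>carrier := H\<rparr>)"
    using center_commute[of _ G] assms(2) subgroup.subset[OF assms(1)]
    by (intro group.group_comm_groupI[OF subgroup_imp_group[OF assms(1)]]) auto
  then show ?thesis
    using finite_p_group_subgroup[OF assms(1)] by (simp add: finite_abelian_p_group_def)
qed

text \<open>Here p^e is the largest order of an element of G/N. A homomorphism from G/N onto the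
  powers of \<open>z\<close> is composed with the projection. \<open>N\<close> will be a normal
  subgroup containing the center in one application and the derived subgroup in the other.\<close>

lemma (in finite_p_group) hom_through_FactGroup:
  assumes N: "N \<lhd> G" and comm: "comm_group (G Mod N)"
  obtains e where "\<And>C. C \<in> carrier (G Mod N) \<Longrightarrow> C [^]\<^bsub>G Mod N\<^esub> (p ^ e) = \<one>\<^bsub>G Mod N\<^esub>"
    "\<And>z. z \<in> center G \<Longrightarrow> z [^] (p ^ e) = \<one> \<Longrightarrow>
      \<exists>f\<in>hom G G. (\<forall>g\<in>carrier G. f g \<in> center G) \<and> (\<forall>x\<in>N. f x = \<one>) \<and> z \<in> f ` carrier G"
proof -
  interpret N: normal N G by fact
  interpret Q: finite_abelian_p_group "G Mod N" p 
    using FactGroup_finite_p_group[OF N] comm by (simp add: finite_abelian_p_group_def)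
  obtain x e where x: "x \<in> carrier (G Mod N)" "Q.ord x = p ^ e"
    and max: "\<And>C. C \<in> carrier (G Mod N) \<Longrightarrow> C [^]\<^bsub>G Mod N\<^esub> (p ^ e) = \<one>\<^bsub>G Mod N\<^esub>"
    using Q.max_order_element by blast
  show thesis
  proof
    show "C [^]\<^bsub>G Mod N\<^esub> (p ^ e) = \<one>\<^bsub>G Mod N\<^esub>" if "C \<in> carrier (G Mod N)" for C by (rule max[OF that])
    fix z assume z: "z \<in> center G" "z [^] (p ^ e) = \<one>"
    have zc: "z \<in> carrier G" using z center_subset[of G] by blast
    obtain F where F: "F \<in> hom (G Mod N) G" "F x = z"
      and Fz: "\<And>C. C \<in> carrier (G Mod N) \<Longrightarrow> \<exists>i::int. F C = z [^] i"
      using Q.hom_onto_root_of_one[OF x max is_group zc z(2)] by blast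
    define f where "f = compose (carrier G) F (\<lambda>g. N #> g)"
    have f: "f g = F (N #> g)" if "g \<in> carrier G" for g using that by (simp add: f_def compose_eq)
    have mem: "N #> g \<in> carrier (G Mod N)" if "g \<in> carrier G" for g
      using that by (auto simp: carrier_FactGroup)
    have "f \<in> hom G G" unfolding f_def using hom_compose[OF N.r_coset_hom_Mod F(1)] .
    moreover have "f g \<in> center G" if g: "g \<in> carrier G" for g
    proof -
      obtain i :: int where "F (N #> g) = z [^] i" using Fz[OF mem[OF g]] by blast
      then show ?thesis using f[OF g] subgroup_int_pow_closed[OF subgroup_center z(1)] by simp
    qed
    moreover have "f g = \<one>" if "g \<in> N" for g
    proof -
      have gc: "g \<in> carrier G" using that by (rule N.mem_carrier)
      have "N #> g = \<one>\<^bsub>G Mod N\<^esub>" using that gc N.subgroup_axioms by (simp add: coset_join2)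
      then show ?thesis using f[OF gc] hom_one[OF F(1) Q.is_group is_group] by simp
    qed
    moreover have "z \<in> f ` carrier G"
    proof -
      obtain g where g: "g \<in> carrier G" "x = N #> g" using x(1) by (auto simp: carrier_FactGroup)
      then have "f g = z" using f F(2) by simp
      then show ?thesis using g(1) by blast
    qed
    ultimately show "\<exists>f\<in>hom G G. (\<forall>g\<in>carrier G. f g \<in> center G) \<and> (\<forall>x\<in>N. f x = \<one>) \<and> z \<in> f ` carrier G"
      by blast
  qed
qed

section \<open>Finite non-abelian p-groups\<close>

locale nonabelian_p_group = finite_p_group +
  assumes not_comm: "\<not> comm_group G"
begin

lemma center_neq_carrier: "center G \<noteq> carrier G"
  using not_comm group_comm_groupI center_commute[of _ G] by metis

lemma center_normal: "center G \<lhd> G"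
proof (rule normal_invI[OF subgroup_center])
  fix g h assume g: "g \<in> carrier G" and h: "h \<in> center G"
  have hc: "h \<in> carrier G" using h center_subset[of G] by blast
  have "g \<otimes> h \<otimes> inv g = h \<otimes> g \<otimes> inv g" using center_commute[OF h g] by simp
  then show "g \<otimes> h \<otimes> inv g \<in> center G" using h hc g by (simp add: m_assoc)
qed

text \<open>There is a proper normal subgroup with abelian quotient, and it contains all
  commutators.\<close>

lemma lower_central_2_neq_carrier: "lower_central G 2 \<noteq> carrier G"
proof
  assume eq: "lower_central G 2 = carrier G"
  obtain M where M: "M \<lhd> G" "M \<noteq> carrier G" "comm_group (G Mod M)"
    using exists_proper_normal_abelian_quotient[OF center_normal center_neq_carrier] by blast
  interpret M: normal M G by fact
  interpret Q: comm_group "G Mod M" by fact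
  have "g \<in> M" if g: "g \<in> carrier G" for g
  proof -
    have "M #> g = \<one>\<^bsub>G Mod M\<^esub>"
    proof (rule hom_trivial_on_lower_central_2[OF Q.is_group M.r_coset_hom_Mod])
      show "g \<in> lower_central G 2" using g eq by simp
      show "(M #> a) \<otimes>\<^bsub>G Mod M\<^esub> (M #> b) = (M #> b) \<otimes>\<^bsub>G Mod M\<^esub> (M #> a)"
        if "a \<in> carrier G" "b \<in> carrier G" for a b
        using that by (intro Q.m_comm) (auto simp: carrier_FactGroup)
    qed
    then show ?thesis using g M.subgroup_axioms M.subset by (metis coset_join1 one_FactGroup)
  qed
  then show False using M.subset M(2) by blast
qed

lemma group_exp_abelianization:
  shows "1 < group_exp (G Mod lower_central G 2)"
    and "0 < m \<Longrightarrow> (\<And>C. C \<in> carrier (G Mod lower_central G 2) \<Longrightarrow>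
      C [^]\<^bsub>G Mod lower_central G 2\<^esub> m = \<one>\<^bsub>G Mod lower_central G 2\<^esub>) \<Longrightarrow>
      group_exp (G Mod lower_central G 2) \<le> m"
proof -
  let ?N = "lower_central G 2" and ?Q = "G Mod lower_central G 2"
  interpret N: normal ?N G by (rule lower_central_normal)
  interpret Q: finite_p_group ?Q p by (rule FactGroup_finite_p_group[OF N.normal_axioms])
  let ?P = "\<lambda>e. 0 < e \<and> (\<forall>g\<in>carrier ?Q. g [^]\<^bsub>?Q\<^esub> e = \<one>\<^bsub>?Q\<^esub>)"
  \<comment> \<open>The group order shows that the \<open>LEAST\<close> in \<open>group_exp\<close>
    is attained.\<close>
  have "?P (order ?Q)" using Q.pow_order_eq_1 Q.order_gt_0_iff_finite Q.finite_carrier by blast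
  then have P: "?P (group_exp ?Q)" unfolding group_exp_def by (rule LeastI)
  have "group_exp ?Q \<noteq> 1"
  proof
    assume "group_exp ?Q = 1"
    then have 1: "C = \<one>\<^bsub>?Q\<^esub>" if "C \<in> carrier ?Q" for C
      using P that by (metis Q.nat_pow_eone)
    have "g \<in> ?N" if g: "g \<in> carrier G" for g
    proof -
      have "?N #> g = ?N" using 1[of "?N #> g"] g by (auto simp: carrier_FactGroup)
      then show ?thesis using g N.subgroup_axioms N.subset by (metis coset_join1)
    qed
    then show False using N.subset lower_central_2_neq_carrier by blast
  qed
  then show "1 < group_exp ?Q" using P by linarith
  show "group_exp ?Q \<le> m" if "0 < m" "\<And>C. C \<in> carrier ?Q \<Longrightarrow> C [^]\<^bsub>?Q\<^esub> m = \<one>\<^bsub>?Q\<^esub>"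
    unfolding group_exp_def using that by (intro Least_le) blast
qed

section \<open>Consequences of the equality of the two automorphism groups\<close>

context
  fixes n :: nat
  assumes n: "n \<ge> 2"
    and auts_eq: "auts_trivial_mod G (lower_central G n) \<inter> auts_fixing G (center G) = central_auts G"
begin

lemma lower_central_subset_center: "lower_central G n \<subseteq> center G"
proof -
  obtain m where m: "n = Suc (Suc m)" using n by (metis Suc_le_D numeral_2_eq_2 Suc_le_mono)
  interpret N: normal "lower_central G n" G by (rule lower_central_normal)
  show ?thesis unfolding m
  proof (rule lower_central_Suc_Suc_subset[OF subgroup_center])
    fix x k assume x: "x \<in> lower_central G (Suc m)" and k: "k \<in> carrier G"
    have xc: "x \<in> carrier G" using x lower_central_subset_carrier by blast
    \<comment> \<open>conjugation by an element of \<open>\<gamma>\<^sub>n\<^sub>-\<^sub>1(G)\<close> is trivial modulo \<open>\<gamma>\<^sub>n(G)\<close> and on \<open>Z(G)\<close>, hence central\<close>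
    let ?\<alpha> = "\<lambda>g\<in>carrier G. x \<otimes> g \<otimes> inv x"
    \<comment> \<open>The displacement of \<open>g\<close> is a conjugate of the commutator of
      \<open>x\<close> and \<open>g\<close>.\<close>
    have eq: "inv g \<otimes> (x \<otimes> g \<otimes> inv x) = inv g \<otimes> (x \<otimes> g \<otimes> inv x \<otimes> inv g) \<otimes> g" if "g \<in> carrier G" for g
      using that xc by (simp add: m_assoc)
    have "?\<alpha> \<in> auts_trivial_mod G (lower_central G n)"
    proof (rule auts_trivial_modI[OF N.normal_axioms finite_carrier conjugation_in_auto[OF xc]])
      fix g assume g: "g \<in> carrier G"
      then have "x \<otimes> g \<otimes> inv x \<otimes> inv g \<in> lower_central G n"
        unfolding m by (rule commutator_in_lower_central[OF x])
      then show "inv g \<otimes> ?\<alpha> g \<in> lower_central G n"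
        using N.inv_op_closed1[OF g] eq[OF g] g by simp
    qed
    moreover have "?\<alpha> \<in> auts_fixing G (center G)"
    proof -
      have "?\<alpha> z = z" if z: "z \<in> center G" for z
      proof -
        have "z \<in> carrier G" using z center_subset[of G] by blast
        then show ?thesis using center_commute[OF z xc] xc by (simp add: m_assoc flip: center_commute[OF z xc])
      qed
      then show ?thesis using conjugation_in_auto[OF xc] unfolding auts_fixing_def by blast
    qed
    ultimately have "?\<alpha> \<in> central_auts G" using auts_eq by blast
    then have "inv k \<otimes> ?\<alpha> k \<in> center G" using k unfolding central_auts_def by blast
    then have "inv k \<otimes> (x \<otimes> k \<otimes> inv x) \<in> center G" using k by simp
    \<comment> \<open>Conjugation by \<open>k\<close> turns this central element into the commutator
      of \<open>x\<close> and \<open>k\<close>.\<close>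
    then have "k \<otimes> (inv k \<otimes> (x \<otimes> k \<otimes> inv x)) \<otimes> inv k \<in> center G"
      using center_normal k by (intro normal.inv_op_closed2)
    moreover have "k \<otimes> (inv k \<otimes> (x \<otimes> k \<otimes> inv x)) \<otimes> inv k = x \<otimes> k \<otimes> inv x \<otimes> inv k"
      using k xc by (simp add: m_assoc[symmetric])
    ultimately show "x \<otimes> k \<otimes> inv x \<otimes> inv k \<in> center G" by simp
  qed
qed

text \<open>The map sending g to g f(g) is a central automorphism, hence trivial modulo
  \<open>\<gamma>\<^sub>n(G)\<close>, and its displacement at g is f(g).\<close>

lemma central_hom_image_inverse_free:
  assumes "f \<in> hom G G" and Z: "\<And>g. g \<in> carrier G \<Longrightarrow> f g \<in> center G"
    and "\<And>x. x \<in> center G \<Longrightarrow> f x = inv x \<Longrightarrow> x = \<one>" and g: "g \<in> carrier G"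
  shows "f g \<in> lower_central G n"
proof -
  have "(\<lambda>g\<in>carrier G. g \<otimes> f g) \<in> central_auts G"
    using assms by (intro central_hom_in_central_auts[OF finite_carrier])
  then have "(\<lambda>g\<in>carrier G. g \<otimes> f g) \<in> auts_trivial_mod G (lower_central G n)" using auts_eq by blast
  then have "inv g \<otimes> (\<lambda>g\<in>carrier G. g \<otimes> f g) g \<in> lower_central G n"
    by (rule auts_trivial_modD[OF lower_central_normal _ g])
  moreover have "f g \<in> carrier G" using Z[OF g] center_subset[of G] by blast
  ultimately show ?thesis using g by (simp add: m_assoc[symmetric])
qed

text \<open>The quotient is taken by some \<open>M\<close> containing the center, so that
  \<open>f\<close> vanishes on Z(G) and f(x) = \<open>inv x\<close> with \<open>x\<close> central
  forces x = 1.\<close>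

lemma center_omega_subset:
  assumes z: "z \<in> center G" "z [^] p = \<one>"
  shows "z \<in> lower_central G n"
proof -
  obtain M where M: "M \<lhd> G" "center G \<subseteq> M" "M \<noteq> carrier G" "comm_group (G Mod M)"
    using exists_proper_normal_abelian_quotient[OF center_normal center_neq_carrier] by blast
  interpret M: normal M G by fact
  obtain e where e: "\<And>C. C \<in> carrier (G Mod M) \<Longrightarrow> C [^]\<^bsub>G Mod M\<^esub> (p ^ e) = \<one>\<^bsub>G Mod M\<^esub>"
    and hom: "\<And>z. z \<in> center G \<Longrightarrow> z [^] (p ^ e) = \<one> \<Longrightarrow>
      \<exists>f\<in>hom G G. (\<forall>g\<in>carrier G. f g \<in> center G) \<and> (\<forall>x\<in>M. f x = \<one>) \<and> z \<in> f ` carrier G"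
    using hom_through_FactGroup[OF M(1,4)] by blast
  \<comment> \<open>G/M is nontrivial; hence p divides p^e, and elements killed by p are admissible
    values of \<open>f\<close>.\<close>
  have "e \<noteq> 0"
  proof
    assume "e = 0"
    interpret Q: group "G Mod M" by (rule M.factorgroup_is_group)
    have "g \<in> M" if g: "g \<in> carrier G" for g
    proof -
      have mem: "M #> g \<in> carrier (G Mod M)" using g by (auto simp: carrier_FactGroup)
      then have "M #> g = M" using e[OF mem] Q.nat_pow_eone[OF mem] \<open>e = 0\<close> by simp
      then show ?thesis using g M.subgroup_axioms M.subset by (metis coset_join1)
    qed
    then show False using M.subset M(3) by blast
  qed
  then obtain e' where e': "e = Suc e'" by (cases e) auto
  have zc: "z \<in> carrier G" using z center_subset[of G] by blast
  have "z [^] (p ^ e) = (z [^] p) [^] (p ^ e')" using zc by (simp add: e' nat_pow_pow)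
  then have "z [^] (p ^ e) = \<one>" using z by simp
  from hom[OF z(1) this] obtain f where f: "f \<in> hom G G" "\<forall>g\<in>carrier G. f g \<in> center G" "\<forall>x\<in>M. f x = \<one>"
    and zf: "z \<in> f ` carrier G" by blast
  obtain g where g: "g \<in> carrier G" "z = f g" using zf by blast
  have "f g \<in> lower_central G n"
  proof (rule central_hom_image_inverse_free[OF f(1) _ _ g(1)])
    show "f h \<in> center G" if "h \<in> carrier G" for h using f(2) that by blast
    fix x assume x: "x \<in> center G" "f x = inv x"
    then have "inv x = \<one>" using f(3) M(2) by auto
    then show "x = \<one>" using x(1) center_subset[of G] by (metis inv_eq_1_iff subsetD)
  qed
  then show ?thesis using g by simp
qed

text \<open>The side condition of the previous lemma is automatic: if \<open>f x = x\<^sup>-\<^sup>1\<close> for some \<open>x \<noteq> 1\<close> in \<open>Z(G)\<close>,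
  then a power \<open>w\<close> of \<open>x\<close> has order \<open>p\<close>, so \<open>w \<in> \<gamma>\<^sub>n(G) \<subseteq> \<gamma>\<^sub>2(G)\<close> and \<open>w\<^sup>-\<^sup>1 = f w = 1\<close>.\<close>

lemma central_hom_image:
  assumes f: "f \<in> hom G G" and Z: "\<And>g. g \<in> carrier G \<Longrightarrow> f g \<in> center G" and g: "g \<in> carrier G"
  shows "f g \<in> lower_central G n"
proof (rule central_hom_image_inverse_free[OF f Z _ g])
  interpret f: group_hom G G f using f is_group by (simp add: group_hom_def group_hom_axioms_def)
  fix x assume x: "x \<in> center G" "f x = inv x"
  have xc: "x \<in> carrier G" using x center_subset[of G] by blast
  obtain j where j: "ord x = p ^ j" using prime_power_ord[OF xc] by blast
  show "x = \<one>"
  proof (cases j)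
    case 0
    then show ?thesis using j ord_eq_1[OF xc] by simp
  next
    case (Suc i)
    define w where "w = x [^] (p ^ i)"
    have wc: "w \<in> carrier G" using xc by (simp add: w_def)
    have "w [^] p = x [^] ord x" using xc by (simp add: w_def nat_pow_pow j Suc mult.commute)
    then have "w [^] p = \<one>" using xc by simp
    moreover have "w \<in> center G"
      using subgroup_int_pow_closed[OF subgroup_center x(1), of "int (p ^ i)"] unfolding w_def int_pow_int .
    ultimately have "w \<in> lower_central G 2" using center_omega_subset lower_central_subset_2[OF n] by blast
    then have "f w = \<one>"
      by (rule hom_trivial_on_lower_central_2[OF is_group f, rotated])
        (use center_commute[OF Z] Z center_subset[of G] in blast)
    moreover have "f w = inv w" unfolding w_def f.hom_nat_pow[OF xc] x(2) using xc by (simp add: nat_pow_inv)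
    ultimately have "w = \<one>" using wc by (metis inv_eq_1_iff)
    then have "p ^ j dvd p ^ i" using pow_eq_id[OF xc] j unfolding w_def by metis
    then have "j \<le> i" using prime_p prime_gt_1_nat power_dvd_imp_le by metis
    then show ?thesis using Suc by simp
  qed
qed

lemma group_rank_eq_and_eq_center_if_var_less:
  shows "group_rank (G\<lparr>carrier := lower_central G n\<rparr>) = group_rank (G\<lparr>carrier := center G\<rparr>)"
    and "subgroup_var p G (lower_central G n) (center G) < group_exp (G Mod lower_central G 2) \<Longrightarrow>
      lower_central G n = center G"
proof -
  have K: "finite_abelian_p_group (G\<lparr>carrier := lower_central G n\<rparr>) p"
    by (rule finite_abelian_p_group_center_subgroup[OF normal_imp_subgroup[OF lower_central_normal] lower_central_subset_center])
  have Z: "finite_abelian_p_group (G\<lparr>carrier := center G\<rparr>) p"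
    by (rule finite_abelian_p_group_center_subgroup[OF subgroup_center order_refl])
  note omega = group_rank_and_var_if_omega_subset[OF K Z lower_central_subset_center center_omega_subset]
  show "group_rank (G\<lparr>carrier := lower_central G n\<rparr>) = group_rank (G\<lparr>carrier := center G\<rparr>)"
    by (rule omega(1))
  assume less: "subgroup_var p G (lower_central G n) (center G) < group_exp (G Mod lower_central G 2)"
  show "lower_central G n = center G"
  proof (rule ccontr)
    assume "lower_central G n \<noteq> center G"
    from omega(2)[OF _ _ this] obtain k x where k: "subgroup_var p G (lower_central G n) (center G) = p ^ k"
      and x: "x \<in> center G" "x \<notin> lower_central G n" "x [^] (p ^ Suc k) = \<one>" by blast
    have comm: "comm_group (G Mod lower_central G 2)"
      unfolding lower_central_2 by (rule derived_quot_is_comm_group)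
    obtain e where e: "\<And>C. C \<in> carrier (G Mod lower_central G 2) \<Longrightarrow>
        C [^]\<^bsub>G Mod lower_central G 2\<^esub> (p ^ e) = \<one>\<^bsub>G Mod lower_central G 2\<^esub>"
      and hom: "\<And>z. z \<in> center G \<Longrightarrow> z [^] (p ^ e) = \<one> \<Longrightarrow>
        \<exists>f\<in>hom G G. (\<forall>g\<in>carrier G. f g \<in> center G) \<and> (\<forall>x\<in>lower_central G 2. f x = \<one>) \<and> z \<in> f ` carrier G"
      using hom_through_FactGroup[OF lower_central_normal comm] by blast
    have p1: "p > 1" using prime_p prime_gt_1_nat by blast
    \<comment> \<open>From p^k < exp \<le> p^e follows k + 1 \<le> e. So \<open>x\<close> is killed
      by p^e and is a value of a homomorphism into the center, which puts it into
      \<open>\<gamma>\<^sub>n(G)\<close>.\<close>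
    have "group_exp (G Mod lower_central G 2) \<le> p ^ e"
      using p1 e by (intro group_exp_abelianization(2)) auto
    then have "p ^ k < p ^ e" using less k by simp
    then have "Suc k \<le> e" using p1 by simp
    then obtain d where d: "e = Suc k + d" using le_Suc_ex by blast
    have xc: "x \<in> carrier G" using x center_subset[of G] by blast
    have "x [^] (p ^ e) = (x [^] (p ^ Suc k)) [^] (p ^ d)" unfolding d power_add using xc by (simp add: nat_pow_pow)
    then have "x [^] (p ^ e) = \<one>" unfolding x(3) by simp
    from hom[OF x(1) this] obtain f where "f \<in> hom G G" "\<forall>g\<in>carrier G. f g \<in> center G" "x \<in> f ` carrier G" by blast
    then show False using central_hom_image x(2) by blast
  qed
qed

end

text \<open>When \<open>\<gamma>\<^sub>n(G)\<close> is the center, acting trivially modulo it is the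
  same as being central. Central automorphisms fix the center elementwise because it now lies in
  \<open>\<gamma>\<^sub>2(G)\<close>.\<close>

lemma lower_central_eq_center_imp:
  assumes n: "n \<ge> 2" and eq: "lower_central G n = center G"
  shows "auts_trivial_mod G (lower_central G n) \<inter> auts_fixing G (center G) = central_auts G"
proof
  show "auts_trivial_mod G (lower_central G n) \<inter> auts_fixing G (center G) \<subseteq> central_auts G"
  proof
    fix \<alpha> assume "\<alpha> \<in> auts_trivial_mod G (lower_central G n) \<inter> auts_fixing G (center G)"
    then have "\<alpha> \<in> auts_trivial_mod G (center G)" using eq by simp
    then have "\<alpha> \<in> auto G" "\<And>g. g \<in> carrier G \<Longrightarrow> inv g \<otimes> \<alpha> g \<in> center G"
      using auts_trivial_modD[OF center_normal] unfolding auts_trivial_mod_def by blast+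
    then show "\<alpha> \<in> central_auts G" unfolding central_auts_def by blast
  qed
  show "central_auts G \<subseteq> auts_trivial_mod G (lower_central G n) \<inter> auts_fixing G (center G)"
  proof
    fix \<alpha> assume \<alpha>: "\<alpha> \<in> central_auts G"
    then have auto: "\<alpha> \<in> auto G" and Z: "\<And>g. g \<in> carrier G \<Longrightarrow> inv g \<otimes> \<alpha> g \<in> center G"
      unfolding central_auts_def by blast+
    have "\<alpha> \<in> auts_trivial_mod G (lower_central G n)"
      unfolding eq by (rule auts_trivial_modI[OF center_normal finite_carrier auto Z])
    moreover have "\<alpha> x = x" if "x \<in> center G" for x
      using that central_auts_fix_lower_central_2[OF \<alpha>] lower_central_subset_2[OF n] eq by blast
    ultimately show "\<alpha> \<in> auts_trivial_mod G (lower_central G n) \<inter> auts_fixing G (center G)"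
      using auto unfolding auts_fixing_def by blast
  qed
qed

end

theorem theorem4p2:
  fixes G :: "('a, 'b) monoid_scheme" and p n :: nat
  assumes "Factorial_Ring.prime p"
    and "group G" and "finite (carrier G)" and "\<exists>k. order G = p ^ k"
    and "\<not> comm_group G"
    and "n \<ge> 2"
  shows
    "(auts_trivial_mod G (lower_central G n) \<inter> auts_fixing G (center G) = central_auts G \<longrightarrow>
        (lower_central G n \<subseteq> center G \<and>
         group_rank (G\<lparr>carrier := lower_central G n\<rparr>) = group_rank (G\<lparr>carrier := center G\<rparr>)) \<and>
        (group_exp (G Mod lower_central G 2) > subgroup_var p G (lower_central G n) (center G) \<longrightarrow>
         lower_central G n = center G)) \<and>
     (lower_central G n = center G \<longrightarrow>
        group_exp (G Mod lower_central G 2) > subgroup_var p G (lower_central G n) (center G) \<and>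
        auts_trivial_mod G (lower_central G n) \<inter> auts_fixing G (center G) = central_auts G)"
proof -
  interpret nonabelian_p_group G p
    by (intro nonabelian_p_group.intro finite_p_group.intro finite_p_group_axioms.intro
        nonabelian_p_group_axioms.intro assms(1-5))
  show ?thesis
  proof (intro conjI impI)
    assume eq: "lower_central G n = center G"
    \<comment> \<open>For equal subgroups \<open>subgroup_var\<close> is 1 by convention, and the
      exponent of the abelianization exceeds 1.\<close>
    show "subgroup_var p G (lower_central G n) (center G) < group_exp (G Mod lower_central G 2)"
      unfolding subgroup_var_def if_P[OF eq] by (rule group_exp_abelianization(1))
    show "auts_trivial_mod G (lower_central G n) \<inter> auts_fixing G (center G) = central_auts G"
      by (rule lower_central_eq_center_imp[OF assms(6) eq])
  next
    assume auts: "auts_trivial_mod G (lower_central G n) \<inter> auts_fixing G (center G) = central_auts G"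
    show "lower_central G n \<subseteq> center G"
      by (rule lower_central_subset_center[OF assms(6) auts])
    show "group_rank (G\<lparr>carrier := lower_central G n\<rparr>) = group_rank (G\<lparr>carrier := center G\<rparr>)"
      by (rule group_rank_eq_and_eq_center_if_var_less(1)[OF assms(6) auts])
    show "lower_central G n = center G"
      if "subgroup_var p G (lower_central G n) (center G) < group_exp (G Mod lower_central G 2)"
      by (rule group_rank_eq_and_eq_center_if_var_less(2)[OF assms(6) auts that])
  qed
qed

end
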